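(* Let $g\ge 1$, let $p_1,\dots,p_g$ be distinct odd primes, $n=p_1\cdots p_g$, $q$ a prime power with $\gcd(n,q)=1$, $N'=\mathrm{ord}_n(q)$, and $\theta$ a primitive $n$-th root of unity in $\mathbb{F}_{q^{N'}}$. Consider the QR codes of length $n$ defined in the context, and let $\mathcal{N}=\prod_{r=0}^{g-1}\bigl(2(2^{g-r}-1)\bigr)^{\binom{g}{r}}$. Then: (1) the number of LCD QR codes of length $n$ is either $0$ or $\mathcal{N}$; (2) the number of self-orthogonal QR codes of length $n$ is either $0$ or $T=2^{g2^{g-1}}$.
   Context: For $0\le r\le g-1$, $A_r$ is the set of all products of $r$ distinct primes among $p_1,\dots,p_g$ ($A_0=\{1\}$). For $d\in A_r$: $M_d=\{j:1\le j\le n-1,\gcd(j,n)=d\}$, $M^*_d=\{Q: Q\mid n/d,\ Q>1\}$, and for $Q\in M^*_d$, $\epsilon\in\{\pm1\}$: $M^\epsilon_{d,Q}=\{j\in M_d:(\tfrac{j}{Q})=\epsilon\}$ (Jacobi symbol), $F^\epsilon_{d,Q}(x)=\prod_{t\in M^\epsilon_{d,Q}}(x-\theta^t)$. A QR code of length $n$ is the cyclic code of length $n$ (an ideal of $K[x]/(x^n-1)$ with $K=\mathbb{F}_{q^{N'}}$, or $K=\mathbb{F}_q$ when the generator has coefficients in $\mathbb{F}_q$) generated by $g(x)=\prod_{r=0}^{g-1}\prod_{d\in A_r}F^{\epsilon_d}_{d,Q_d}(x)$, for a choice of $Q_d\in M^*_d$ and $\epsilon_d\in\{1,-1\}$ for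 each $d\in\bigcup_r A_r$. A linear code $\mathcal{C}$ is LCD if $\mathcal{C}\cap\mathcal{C}^\perp=\{0\}$, and (in this paper's terminology) self-orthogonal if $\mathcal{C}\cap\mathcal{C}^\perp=\mathcal{C}^\perp$, i.e. $\mathcal{C}^\perp\subseteq\mathcal{C}$. *)

theory Defs
  imports
    "HOL-Number_Theory.Number_Theory"
    "HOL-Computational_Algebra.Polynomial"
    "HOL-Library.Cardinality"
begin

section \<open>Arithmetic\<close>

definition Jacobi :: "int \<Rightarrow> nat \<Rightarrow> int" where
  "Jacobi a Q = (\<Prod>\<^sub># (image_mset (\<lambda>l. Legendre a (int l)) (prime_factorization Q)))"

definition primitive_root_of_unity :: "nat \<Rightarrow> 'a::field \<Rightarrow> bool" where
  "primitive_root_of_unity n \<theta> \<longleftrightarrow> n > 0 \<and> \<theta> ^ n = 1 \<and> (\<forall>k. 0 < k \<and> k < n \<longrightarrow> \<theta> ^ k \<noteq> 1)"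

text \<open>
  Inside a finite field with \<open>q ^ m\<close> elements (\<open>m \<ge> 1\<close>), the unique subfield with \<open>q\<close> elements
  consists of the roots of \<open>x ^ q - x\<close>.
\<close>

definition subfield_of_card :: "nat \<Rightarrow> 'a::field set" where
  "subfield_of_card q = {x. x ^ q = x}"

section \<open>Cyclic codes\<close>

text \<open>
  The ambient field is the whole type; \<open>K\<close> is a subfield of it. A word \<open>(c\<^sub>0, \<dots>, c\<^sub>n\<^sub>-\<^sub>1)\<close> over
  \<open>K\<close> is identified with the polynomial \<open>c\<^sub>0 + \<dots> + c\<^sub>n\<^sub>-\<^sub>1 x\<^sup>n\<^sup>-\<^sup>1\<close>, which is also the canonical
  representative of its class in \<open>K[x]/(x\<^sup>n - 1)\<close>.
\<close>

definition poly_over :: "'a::field set \<Rightarrow> 'a poly set" where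
  "poly_over K = {f. \<forall>i. coeff f i \<in> K}"

definition words :: "'a::field set \<Rightarrow> nat \<Rightarrow> 'a poly set" where
  "words K n = {f \<in> poly_over K. \<forall>i\<ge>n. coeff f i = 0}"

definition cyclic_code :: "'a::field set \<Rightarrow> nat \<Rightarrow> 'a poly \<Rightarrow> 'a poly set" where
  "cyclic_code K n h = {(a * h) mod (monom 1 n - 1) | a. a \<in> poly_over K}"

definition dual_code :: "'a::field set \<Rightarrow> nat \<Rightarrow> 'a poly set \<Rightarrow> 'a poly set" where
  "dual_code K n C = {v \<in> words K n. \<forall>c\<in>C. (\<Sum>i<n. coeff v i * coeff c i) = 0}"

definition LCD_code :: "'a::field set \<Rightarrow> nat \<Rightarrow> 'a poly set \<Rightarrow> bool" where
  "LCD_code K n C \<longleftrightarrow> C \<inter> dual_code K n C = {0}"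

text \<open>This is the dual-containing convention, not \<open>C \<subseteq> C\<^sup>\<bottom>\<close>.\<close>

definition self_orthogonal :: "'a::field set \<Rightarrow> nat \<Rightarrow> 'a poly set \<Rightarrow> bool" where
  "self_orthogonal K n C \<longleftrightarrow> C \<inter> dual_code K n C = dual_code K n C"

section \<open>QR codes of square-free length\<close>

definition A_set :: "(nat \<Rightarrow> nat) \<Rightarrow> nat \<Rightarrow> nat \<Rightarrow> nat set" where
  "A_set p g r = {\<Prod>i\<in>I. p i | I. I \<subseteq> {1..g} \<and> card I = r}"

definition M_set :: "nat \<Rightarrow> nat \<Rightarrow> nat set" where
  "M_set n d = {j. 1 \<le> j \<and> j \<le> n - 1 \<and> gcd j n = d}"

definition M_star :: "nat \<Rightarrow> nat \<Rightarrow> nat set" where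
  "M_star n d = {Q. Q dvd n div d \<and> Q > 1}"

definition M_eps :: "nat \<Rightarrow> nat \<Rightarrow> nat \<Rightarrow> int \<Rightarrow> nat set" where
  "M_eps n d Q e = {j \<in> M_set n d. Jacobi (int j) Q = e}"

definition F_poly :: "nat \<Rightarrow> 'a::field \<Rightarrow> nat \<Rightarrow> nat \<Rightarrow> int \<Rightarrow> 'a poly" where
  "F_poly n \<theta> d Q e = (\<Prod>t\<in>M_eps n d Q e. [:- (\<theta> ^ t), 1:])"

definition qr_generator ::
  "(nat \<Rightarrow> nat) \<Rightarrow> nat \<Rightarrow> 'a::field \<Rightarrow> (nat \<Rightarrow> nat) \<Rightarrow> (nat \<Rightarrow> int) \<Rightarrow> 'a poly" where
  "qr_generator p g \<theta> Q e =
     (\<Prod>r=0..g-1. \<Prod>d\<in>A_set p g r. F_poly (\<Prod>i=1..g. p i) \<theta> d (Q d) (e d))"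

text \<open>The QR codes over \<open>K\<close>: only generators with all coefficients in \<open>K\<close> are admitted.\<close>

definition qr_codes :: "'a::field set \<Rightarrow> (nat \<Rightarrow> nat) \<Rightarrow> nat \<Rightarrow> 'a \<Rightarrow> 'a poly set set" where
  "qr_codes K p g \<theta> =
     {cyclic_code K (\<Prod>i=1..g. p i) (qr_generator p g \<theta> Q e) | Q e.
        (\<forall>d \<in> (\<Union>r\<in>{0..g-1}. A_set p g r).
           Q d \<in> M_star (\<Prod>i=1..g. p i) d \<and> e d \<in> {1, -1}) \<and>
        qr_generator p g \<theta> Q e \<in> poly_over K}"

end

theory Submission
  imports Defs "HOL-Computational_Algebra.Squarefree"
begin

text \<open>
  Parseval's identity over the \<open>n\<close>-th roots of unity shows that the cyclic code with zero set \<open>S\<close>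
  has as its dual the code with zero set \<open>{x. 1/x \<notin> S}\<close>. Hence it is LCD iff \<open>S = 1/S\<close>, and it
  contains its dual iff \<open>S\<close> and \<open>1/S\<close> are disjoint; likewise its generator has coefficients in the
  field with \<open>q\<close> elements iff \<open>S\<close> is closed under \<open>x \<mapsto> x ^ q\<close>. For the zero set given by
  \<open>(Q\<^sub>d, \<epsilon>\<^sub>d)\<close>, the multiplicativity of the Jacobi symbol turns these into the conditions
  \<open>(-1/Q\<^sub>d) = 1\<close>, \<open>(-1/Q\<^sub>d) = -1\<close> and \<open>(q/Q\<^sub>d) = 1\<close> for all \<open>d\<close>, and different choices give
  different codes. As \<open>Q\<^sub>d\<close> must be \<open>p\<^sub>i\<close> when \<open>d = n/p\<^sub>i\<close>, one code with such a property forces the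
  condition at every \<open>p\<^sub>i\<close>. Then every choice yields an LCD code, and exactly the choices where
  each \<open>Q\<^sub>d\<close> has an odd number of prime factors yield a self-orthogonal code.
\<close>

section \<open>Zero sets and duals of cyclic codes\<close>

definition root_poly :: "'a::field set \<Rightarrow> 'a poly" where
  "root_poly S = (\<Prod>x\<in>S. [:- x, 1:])"

definition vanishing_words :: "'a::field set \<Rightarrow> nat \<Rightarrow> 'a set \<Rightarrow> 'a poly set" where
  "vanishing_words K n S = {c \<in> words K n. \<forall>x\<in>S. poly c x = 0}"

lemma poly_root_poly_eq_0_iff:
  "finite S \<Longrightarrow> poly (root_poly S) x = 0 \<longleftrightarrow> x \<in> S"
  by (auto simp: root_poly_def poly_prod)

lemma root_poly_neq_0 [simp]: "root_poly S \<noteq> 0"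
  by (cases "finite S") (auto simp: root_poly_def)

lemma degree_root_poly: "degree (root_poly S) = card S"
  unfolding root_poly_def by (subst degree_prod_eq_sum_degree) auto

lemma root_poly_dvd:
  assumes "finite S" "\<And>x. x \<in> S \<Longrightarrow> poly c x = 0"
  shows "root_poly S dvd c"
  using assms
proof (induction S arbitrary: c rule: finite_induct)
  case empty
  then show ?case by (simp add: root_poly_def)
next
  case (insert x S)
  then obtain c' where c': "c = [:- x, 1:] * c'"
    by (metis dvdE insertI1 poly_eq_0_iff_dvd)
  have "root_poly S dvd c'"
  proof (rule insert.IH)
    fix y assume "y \<in> S"
    then have "poly c y = 0" "y \<noteq> x" using insert by auto
    then show "poly c' y = 0" by (auto simp: c')
  qed
  then have "[:- x, 1:] * root_poly S dvd [:- x, 1:] * c'" by (rule mult_dvd_mono[OF dvd_refl])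
  moreover have "root_poly (insert x S) = [:- x, 1:] * root_poly S"
    using insert.hyps unfolding root_poly_def by (rule prod.insert)
  ultimately show ?case by (simp only: c')
qed

lemma words_degree_less:
  assumes "c \<in> words K n" "n > 0"
  shows "degree c < n"
proof (rule ccontr)
  assume "\<not> degree c < n"
  then have "lead_coeff c = 0" using assms by (simp add: words_def)
  then show False using assms \<open>\<not> degree c < n\<close> by simp
qed

lemma poly_altdef_bounded:
  fixes p :: "'a::field poly"
  assumes "degree p < n"
  shows "poly p x = (\<Sum>i<n. coeff p i * x ^ i)"
proof -
  have "(\<Sum>i<n. coeff p i * x ^ i) = (\<Sum>i\<le>degree p. coeff p i * x ^ i)"
    by (rule sum.mono_neutral_right) (use assms in \<open>auto intro: le_degree\<close>)
  then show ?thesis by (simp add: poly_altdef)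
qed

text \<open>
  Both base fields of the theorem have the form \<open>{x. x ^ s = x}\<close>: take \<open>s = 1\<close> for the whole field
  and \<open>s = q\<close> for the subfield with \<open>q\<close> elements.
\<close>

locale fixed_field_code =
  fixes n s :: nat and \<theta> :: "'a::field" and K :: "'a set"
  assumes prim: "primitive_root_of_unity n \<theta>"
    and s_pos: "s > 0"
    and add_pow: "\<And>x y :: 'a. (x + y) ^ s = x ^ s + y ^ s"
    and n_neq_0: "of_nat n \<noteq> (0 :: 'a)"
    and K_def: "K = {x. x ^ s = x}"
begin

section \<open>The \<open>n\<close>-th roots of unity and Parseval's identity\<close>

definition U :: "'a set" where "U = {x. x ^ n = 1}"

definition frob :: "'a poly \<Rightarrow> 'a poly" where "frob = map_poly (\<lambda>x. x ^ s)"

lemma n_pos: "n > 0" using prim by (simp add: primitive_root_of_unity_def)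

lemma theta_pow_n: "\<theta> ^ n = 1" using prim by (simp add: primitive_root_of_unity_def)

lemma theta_neq_0: "\<theta> \<noteq> 0" using theta_pow_n n_pos by (auto simp: power_0_left)

lemma inj_on_theta_pow: "inj_on (\<lambda>j. \<theta> ^ j) {..<n}"
proof (rule linorder_inj_onI)
  fix i j assume ij: "i < j" "i \<in> {..<n}" "j \<in> {..<n}"
  have "\<theta> ^ (j - i) \<noteq> 1"
    using prim ij by (auto simp: primitive_root_of_unity_def)
  moreover have "\<theta> ^ j = \<theta> ^ i * \<theta> ^ (j - i)" using ij by (simp flip: power_add)
  ultimately show "\<theta> ^ i \<noteq> \<theta> ^ j" using theta_neq_0 by auto
qed auto

lemma theta_pow_mod: "\<theta> ^ (j mod n) = \<theta> ^ j"
proof -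
  have "\<theta> ^ j = \<theta> ^ (n * (j div n) + j mod n)" by simp
  also have "\<dots> = \<theta> ^ (j mod n)" by (simp only: power_add power_mult theta_pow_n) simp
  finally show ?thesis ..
qed

lemma theta_pow_in_U: "\<theta> ^ j \<in> U"
  unfolding U_def mem_Collect_eq power_mult[symmetric] mult.commute[of j n]
  by (simp only: power_mult theta_pow_n power_one)

lemma xn_minus_1: "monom 1 n - 1 \<noteq> (0 :: 'a poly)" "degree (monom 1 n - 1 :: 'a poly) = n"
proof -
  show d: "degree (monom 1 n - 1 :: 'a poly) = n"
    using n_pos degree_add_eq_left[of "- 1 :: 'a poly" "monom 1 n"]
    by (simp add: degree_monom_eq)
  show "monom 1 n - 1 \<noteq> (0 :: 'a poly)" using d n_pos by force
qed

lemma U_eq_roots: "U = {x. poly (monom 1 n - 1) x = 0}"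
  by (simp add: U_def poly_monom)

lemma finite_U: "finite U"
  unfolding U_eq_roots using xn_minus_1 by (intro poly_roots_finite)

text \<open>The \<open>n\<close> distinct powers of \<open>\<theta>\<close> already exhaust the
  roots of a polynomial of degree \<open>n\<close>.\<close>

lemma U_eq: "U = (\<lambda>j. \<theta> ^ j) ` {..<n}"
proof -
  have "card U \<le> n"
    unfolding U_eq_roots using card_poly_roots_bound[OF xn_minus_1(1)] xn_minus_1(2) by simp
  moreover have "card ((\<lambda>j. \<theta> ^ j) ` {..<n}) = n" by (simp add: card_image inj_on_theta_pow)
  ultimately show ?thesis
    using finite_U theta_pow_in_U by (intro card_seteq[symmetric]) auto
qed

lemma card_U: "card U = n"
  by (simp add: U_eq card_image inj_on_theta_pow)

lemma U_neq_0: "x \<in> U \<Longrightarrow> x \<noteq> 0"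
  using n_pos by (auto simp: U_def power_0_left)

lemma inverse_in_U [simp]: "inverse x \<in> U \<longleftrightarrow> x \<in> U"
  by (simp add: U_def power_inverse)

lemma pow_in_U: "x \<in> U \<Longrightarrow> x ^ k \<in> U"
  unfolding U_def mem_Collect_eq power_mult[symmetric] mult.commute[of k n]
  by (simp only: power_mult power_one)

text \<open>Orthogonality of characters: replacing \<open>x\<close> by \<open>\<theta> * x\<close>
  permutes \<open>U\<close> and multiplies the sum by \<open>\<theta> ^ k / \<theta> ^ i\<close>,
  which differs from 1 when \<open>i\<close> and \<open>k\<close> are distinct and below
  \<open>n\<close>.\<close>

lemma sum_U_power: 
  assumes "i < n" "k < n"
  shows "(\<Sum>x\<in>U. inverse x ^ i * x ^ k) = (if i = k then of_nat n else 0)"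
proof (cases "i = k")
  case True
  have "(\<Sum>x\<in>U. inverse x ^ i * x ^ k) = (\<Sum>x\<in>U. 1)"
    using U_neq_0 True by (intro sum.cong) (auto simp flip: power_mult_distrib)
  then show ?thesis using True by (simp add: card_U)
next
  case False
  let ?S = "\<Sum>x\<in>U. inverse x ^ i * x ^ k"
  have "bij_betw (\<lambda>x. \<theta> * x) U U"
    by (rule bij_betwI[where g = "\<lambda>x. inverse \<theta> * x"])
      (use theta_neq_0 theta_pow_n in \<open>auto simp: U_def power_mult_distrib power_inverse\<close>)
  then have "?S = (\<Sum>x\<in>U. inverse (\<theta> * x) ^ i * (\<theta> * x) ^ k)"
    by (rule sum.reindex_bij_betw[symmetric])
  also have "\<dots> = inverse \<theta> ^ i * \<theta> ^ k * ?S"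
    by (simp add: sum_distrib_left power_mult_distrib mult_ac)
  finally have "?S = 0 \<or> inverse \<theta> ^ i * \<theta> ^ k = 1" by simp
  moreover have "\<theta> ^ i \<noteq> \<theta> ^ k"
    using False assms inj_on_theta_pow by (auto dest: inj_onD)
  then have "inverse \<theta> ^ i * \<theta> ^ k \<noteq> 1"
    using theta_neq_0 by (auto simp: field_simps)
  ultimately show ?thesis using False by simp
qed

text \<open>Expanding both values and applying orthogonality leaves the diagonal terms. The value of
  \<open>v\<close> at \<open>1/x\<close> meets that of \<open>c\<close> at \<open>x\<close>; this is
  where inversion of zeros comes from.\<close>

lemma parseval:
  assumes "degree v < n" "degree c < n"
  shows "of_nat n * (\<Sum>i<n. coeff v i * coeff c i) = (\<Sum>x\<in>U. poly v (inverse x) * poly c x)"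
proof -
  have "(\<Sum>x\<in>U. poly v (inverse x) * poly c x) =
      (\<Sum>x\<in>U. \<Sum>i<n. \<Sum>k<n. coeff v i * coeff c k * (inverse x ^ i * x ^ k))"
    unfolding poly_altdef_bounded[OF assms(1)] poly_altdef_bounded[OF assms(2)] sum_product
    by (intro sum.cong refl) (simp add: mult_ac)
  also have "\<dots> = (\<Sum>i<n. \<Sum>k<n. coeff v i * coeff c k * (\<Sum>x\<in>U. inverse x ^ i * x ^ k))"
    unfolding sum_distrib_left by (subst sum.swap, rule sum.cong[OF refl], rule sum.swap)
  also have "\<dots> = (\<Sum>i<n. \<Sum>k<n. coeff v i * coeff c k * (if i = k then of_nat n else 0))"
    by (intro sum.cong refl) (simp add: sum_U_power)
  also have "\<dots> = (\<Sum>i<n. coeff v i * coeff c i * of_nat n)"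
    by (intro sum.cong refl) (simp add: if_distrib[of "\<lambda>z. _ * z"] cong: if_cong)
  finally show ?thesis by (simp add: sum_distrib_left mult_ac)
qed

section \<open>The \<open>s\<close>-th power map on elements and coefficients\<close>

lemma zero_pow [simp]: "(0::'a) ^ s = 0" using s_pos by simp

text \<open>Additivity at \<open>x\<close> and \<open>- x\<close> gives this without a case split on
  the parity of \<open>s\<close> or the characteristic.\<close>

lemma minus_pow: "(- x :: 'a) ^ s = - (x ^ s)"
  using add_pow[of x "-x"] by (simp add: eq_neg_iff_add_eq_0 add.commute)

lemma diff_pow: "(x - y :: 'a) ^ s = x ^ s - y ^ s"
  using add_pow[of x "-y"] by (simp add: minus_pow)

lemma sum_pow: "(sum f A :: 'a) ^ s = (\<Sum>i\<in>A. f i ^ s)"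
  by (induction A rule: infinite_finite_induct) (auto simp: add_pow)

lemma pow_s_inject: "(x::'a) ^ s = y ^ s \<longleftrightarrow> x = y"
proof
  assume "x ^ s = y ^ s"
  then have "(x - y) ^ s = 0" by (simp add: diff_pow)
  then show "x = y" using s_pos by simp
qed auto

lemma coeff_frob [simp]: "coeff (frob f) i = coeff f i ^ s"
  by (simp add: frob_def coeff_map_poly)

text \<open>As \<open>K\<close> is the fixed set of a power map, having coefficients in
  \<open>K\<close> becomes an equation that can be transported through products, quotients and
  remainders.\<close>

lemma poly_over_K_iff: "f \<in> poly_over K \<longleftrightarrow> frob f = f"
  by (auto simp: poly_over_def K_def poly_eq_iff)

lemma frob_add: "frob (f + g) = frob f + frob g"
  and frob_diff: "frob (f - g) = frob f - frob g"
  by (simp_all add: poly_eq_iff add_pow diff_pow)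

lemma frob_mult: "frob (f * g) = frob f * frob g"
  by (simp add: poly_eq_iff coeff_mult sum_pow power_mult_distrib)

lemma frob_0 [simp]: "frob 0 = 0" and frob_1 [simp]: "frob 1 = 1"
  by (simp_all add: poly_eq_iff)

lemma frob_monom_1 [simp]: "frob (monom 1 k) = monom 1 k"
  by (simp add: poly_eq_iff)

lemma frob_prod: "frob (prod f A) = (\<Prod>x\<in>A. frob (f x))"
  by (induction A rule: infinite_finite_induct) (auto simp: frob_mult)

lemma frob_linear: "frob [:- x, 1:] = [:- (x ^ s), 1:]"
  by (auto simp: poly_eq_iff coeff_pCons minus_pow split: nat.splits)

lemma degree_frob [simp]: "degree (frob f) = degree f"
  unfolding frob_def using s_pos by (cases "f = 0") (auto intro: map_poly_degree_eq)

text \<open>Consequently \<open>x \<mapsto> x ^ s\<close> sends zeros of \<open>f\<close> to zeros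
  of \<open>frob f\<close>.\<close>

lemma poly_frob: "poly (frob f) (x ^ s) = poly f x ^ s"
  unfolding poly_altdef degree_frob coeff_frob sum_pow power_mult_distrib power_mult[symmetric]
  by (simp only: mult.commute)

section \<open>Reduction modulo \<open>x ^ n - 1\<close> and cyclic codes described by zeros\<close>

lemma degree_mod_xn: "degree (f mod (monom 1 n - 1) :: 'a poly) < n"
  using degree_mod_less'[OF xn_minus_1(1), of f] xn_minus_1(2) n_pos
  by (cases "f mod (monom 1 n - 1) = 0") auto

text \<open>The modulus is fixed by \<open>frob\<close> and degrees are preserved, so
  \<open>frob\<close> turns a division with remainder into another one; remainders are
  unique.\<close>

lemma frob_mod: "frob (f mod (monom 1 n - 1)) = frob f mod (monom 1 n - 1)"
proof -
  let ?m = "monom 1 n - 1 :: 'a poly"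
  have "frob f = frob (f div ?m * ?m + f mod ?m)" by (simp only: div_mult_mod_eq)
  also have "\<dots> = frob (f div ?m) * ?m + frob (f mod ?m)"
    by (simp only: frob_add frob_mult frob_diff frob_monom_1 frob_1)
  finally have "frob f mod ?m = frob (f mod ?m) mod ?m" by simp
  then show ?thesis using degree_mod_xn[of f] by (simp add: mod_poly_less xn_minus_1(2))
qed

lemma words_iff: "c \<in> words K n \<longleftrightarrow> frob c = c \<and> degree c < n"
  using words_degree_less[of c K n] n_pos
  by (auto simp: words_def poly_over_K_iff intro: coeff_eq_0)

lemma poly_mod_xn: "x \<in> U \<Longrightarrow> poly (f mod (monom 1 n - 1)) x = poly f x"
proof -
  assume "x \<in> U"
  let ?m = "monom 1 n - 1 :: 'a poly"
  have "poly f x = poly (f div ?m * ?m + f mod ?m) x" by (simp only: div_mult_mod_eq)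
  also have "\<dots> = poly (f mod ?m) x" using \<open>x \<in> U\<close> unfolding U_eq_roots by simp
  finally show ?thesis ..
qed

text \<open>If \<open>frob\<close> fixes the polynomial, \<open>poly_frob\<close> moves zeros to
  zeros. Conversely, the injective power map permutes the finite set \<open>S\<close>, so
  \<open>frob\<close> merely permutes the linear factors.\<close>

lemma root_poly_over_K_iff:
  assumes "finite S"
  shows "root_poly S \<in> poly_over K \<longleftrightarrow> (\<forall>x\<in>S. x ^ s \<in> S)"
proof
  assume "root_poly S \<in> poly_over K"
  then have *: "frob (root_poly S) = root_poly S" by (simp add: poly_over_K_iff)
  show "\<forall>x\<in>S. x ^ s \<in> S"
  proof
    fix x assume "x \<in> S"
    then have "poly (root_poly S) x = 0" using assms by (simp add: poly_root_poly_eq_0_iff)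
    then have "poly (root_poly S) (x ^ s) = 0" using poly_frob[of "root_poly S" x] * by simp
    then show "x ^ s \<in> S" using assms by (simp add: poly_root_poly_eq_0_iff)
  qed
next
  assume closed: "\<forall>x\<in>S. x ^ s \<in> S"
  have inj: "inj_on (\<lambda>x. x ^ s) S" by (simp add: inj_on_def pow_s_inject)
  have "(\<lambda>x. x ^ s) ` S = S"
    using closed assms inj by (intro card_seteq) (auto simp: card_image)
  then have "bij_betw (\<lambda>x. x ^ s) S S" using inj by (simp add: bij_betw_def)
  then have "frob (root_poly S) = root_poly S"
    unfolding root_poly_def frob_prod frob_linear by (rule prod.reindex_bij_betw)
  then show "root_poly S \<in> poly_over K" by (simp add: poly_over_K_iff)
qed

text \<open>Reduction modulo \<open>x ^ n - 1\<close> does not change values on \<open>U\<close>, so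
  every codeword vanishes on \<open>S\<close>. A word vanishing on \<open>S\<close> is a multiple of
  the generator and is its own remainder.\<close>

lemma cyclic_code_root_poly:
  assumes "S \<subseteq> U" "root_poly S \<in> poly_over K"
  shows "cyclic_code K n (root_poly S) = vanishing_words K n S"
proof (intro equalityI subsetI)
  have fin: "finite S" using assms finite_U finite_subset by blast
  have frob_S: "frob (root_poly S) = root_poly S" using assms by (simp add: poly_over_K_iff)
  fix c
  {
    assume "c \<in> cyclic_code K n (root_poly S)"
    then obtain a where a: "frob a = a" "c = (a * root_poly S) mod (monom 1 n - 1)"
      by (auto simp: cyclic_code_def poly_over_K_iff)
    have "c \<in> words K n"
      by (simp add: words_iff a frob_mod frob_mult frob_S degree_mod_xn)
    moreover have "poly c x = 0" if "x \<in> S" for x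
      using that assms fin by (auto simp: a poly_mod_xn poly_root_poly_eq_0_iff)
    ultimately show "c \<in> vanishing_words K n S" by (simp add: vanishing_words_def)
  }
  {
    assume c: "c \<in> vanishing_words K n S"
    then have "root_poly S dvd c"
      by (intro root_poly_dvd fin) (auto simp: vanishing_words_def)
    then obtain a where a: "c = a * root_poly S" by (metis dvdE mult.commute)
    have "frob c = c" "degree c < n" using c by (auto simp: vanishing_words_def words_iff)
    \<comment> \<open>Cancelling the nonzero generator shows that the cofactor, found by division
      over the whole field, has coefficients in \<open>K\<close>.\<close>
    then have "frob a * root_poly S = a * root_poly S" by (simp add: a frob_mult frob_S)
    then have "frob a = a" by simp
    moreover have "c = (a * root_poly S) mod (monom 1 n - 1)"
      using \<open>degree c < n\<close> by (simp add: a mod_poly_less xn_minus_1(2))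
    ultimately show "c \<in> cyclic_code K n (root_poly S)"
      by (auto simp: cyclic_code_def poly_over_K_iff)
  }
qed

lemma vanishing_words_U: "vanishing_words K n U = {0}"
proof -
  have "c = 0" if "c \<in> vanishing_words K n U" for c
  proof (rule ccontr)
    assume "c \<noteq> 0"
    moreover have "root_poly U dvd c"
      using that by (intro root_poly_dvd finite_U) (auto simp: vanishing_words_def)
    ultimately have "n \<le> degree c" using dvd_imp_degree_le by (metis card_U degree_root_poly)
    then show False using that by (auto simp: vanishing_words_def words_iff)
  qed
  then show ?thesis using n_pos by (auto simp: vanishing_words_def words_iff)
qed

text \<open>Properness of \<open>S\<close> keeps the degree \<open>card S\<close> below
  \<open>n\<close>, so the unreduced generator is itself a word.\<close>

lemma vanishing_words_root_poly:
  assumes "S \<subset> U" "root_poly S \<in> poly_over K"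
  shows "root_poly S \<in> vanishing_words K n S"
proof -
  have "finite S" using assms finite_U finite_subset by blast
  then show ?thesis
    using assms psubset_card_mono[OF finite_U, of S] card_U
    by (auto simp: vanishing_words_def words_iff poly_over_K_iff degree_root_poly
        poly_root_poly_eq_0_iff)
qed

text \<open>The generator \<open>root_poly S\<close> vanishes exactly on \<open>S\<close>, so this
  one word decides the inclusion.\<close>

lemma vanishing_words_mono_iff:
  assumes "S \<subset> U" "T \<subseteq> U" "root_poly S \<in> poly_over K"
  shows "vanishing_words K n S \<subseteq> vanishing_words K n T \<longleftrightarrow> T \<subseteq> S"
proof
  assume "vanishing_words K n S \<subseteq> vanishing_words K n T"
  with vanishing_words_root_poly[OF assms(1,3)] have "\<forall>x\<in>T. poly (root_poly S) x = 0"
    by (auto simp: vanishing_words_def)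
  then show "T \<subseteq> S"
    using assms finite_U finite_subset by (metis poly_root_poly_eq_0_iff psubset_imp_subset subsetI)
qed (auto simp: vanishing_words_def)

lemma cyclic_code_root_poly_eq_iff:
  assumes "S \<subset> U" "T \<subset> U" "root_poly S \<in> poly_over K" "root_poly T \<in> poly_over K"
  shows "cyclic_code K n (root_poly S) = cyclic_code K n (root_poly T) \<longleftrightarrow> S = T"
  using assms vanishing_words_mono_iff[of S T] vanishing_words_mono_iff[of T S]
  by (auto simp: cyclic_code_root_poly)

section \<open>Dual codes and the two criteria on zero sets\<close>

definition dual_zeros :: "'a set \<Rightarrow> 'a set" where
  "dual_zeros S = {x \<in> U. inverse x \<notin> S}"

text \<open>For a dual word, testing against multiples of the generator kills every product of
  \<open>v\<close> at \<open>1/x\<close> with the generator at \<open>x\<close>; the second factor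
  is nonzero off \<open>S\<close>. Conversely, each term of Parseval's sum vanishes, and
  \<open>n\<close> is invertible in the field.\<close>

lemma dual_code_root_poly:
  assumes "S \<subseteq> U" "root_poly S \<in> poly_over K"
  shows "dual_code K n (cyclic_code K n (root_poly S)) = vanishing_words K n (dual_zeros S)"
proof (intro equalityI subsetI)
  let ?C = "cyclic_code K n (root_poly S)"
  have fin: "finite S" using assms finite_U finite_subset by blast
  fix v
  {
    assume "v \<in> dual_code K n ?C"
    then have v: "v \<in> words K n" "\<And>c. c \<in> ?C \<Longrightarrow> (\<Sum>i<n. coeff v i * coeff c i) = 0"
      by (auto simp: dual_code_def)
    define w where "w x = poly v (inverse x) * poly (root_poly S) x" for x
    have pow: "(\<Sum>x\<in>U. x ^ k * w x) = 0" for k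
    proof -
      \<comment> \<open>Monomial multipliers lie over every \<open>K\<close>. Linearity then extends
        the vanishing to arbitrary \<open>f\<close>, including polynomials with coefficients outside
        \<open>K\<close>.\<close>
      define c where "c = (monom 1 k * root_poly S) mod (monom 1 n - 1)"
      have "c \<in> ?C" unfolding c_def cyclic_code_def by (auto simp: poly_over_K_iff)
      then have "(\<Sum>x\<in>U. poly v (inverse x) * poly c x) = 0"
        using v parseval[of v c] by (simp add: words_iff c_def degree_mod_xn)
      moreover have "poly v (inverse x) * poly c x = x ^ k * w x" if "x \<in> U" for x
        using that by (simp add: c_def w_def poly_mod_xn poly_monom)
      ultimately show ?thesis by simp
    qed
    have all: "(\<Sum>x\<in>U. poly f x * w x) = 0" for f
    proof -
      have "(\<Sum>x\<in>U. poly f x * w x) = (\<Sum>x\<in>U. \<Sum>i\<le>degree f. coeff f i * (x ^ i * w x))"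
        unfolding poly_altdef sum_distrib_right by (simp only: mult.assoc)
      also have "\<dots> = (\<Sum>i\<le>degree f. coeff f i * (\<Sum>x\<in>U. x ^ i * w x))"
        by (subst sum.swap) (simp add: sum_distrib_left)
      finally show ?thesis by (simp add: pow)
    qed
    have w0: "w x = 0" if "x \<in> U" for x
    proof -
      \<comment> \<open>An unnormalized Lagrange polynomial: it isolates the single term at
        \<open>x\<close>.\<close>
      let ?f = "root_poly (U - {x})"
      have "(\<Sum>y\<in>U. poly ?f y * w y) = (\<Sum>y\<in>{x}. poly ?f y * w y)"
        by (rule sum.mono_neutral_right)
          (use that finite_U in \<open>auto simp: poly_root_poly_eq_0_iff\<close>)
      then have "poly ?f x * w x = 0" using all by simp
      then show ?thesis using finite_U by (auto simp: poly_root_poly_eq_0_iff)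
    qed
    have "poly v x = 0" if "x \<in> dual_zeros S" for x
      using w0[of "inverse x"] that fin
      by (auto simp: w_def dual_zeros_def poly_root_poly_eq_0_iff)
    then show "v \<in> vanishing_words K n (dual_zeros S)" using v by (simp add: vanishing_words_def)
  }
  {
    assume v: "v \<in> vanishing_words K n (dual_zeros S)"
    have "(\<Sum>i<n. coeff v i * coeff c i) = 0" if "c \<in> ?C" for c
    proof -
      have c: "c \<in> vanishing_words K n S" using that assms by (simp add: cyclic_code_root_poly)
      have "poly v (inverse x) * poly c x = 0" if "x \<in> U" for x
        using that v c by (cases "x \<in> S") (auto simp: vanishing_words_def dual_zeros_def)
      then have "(\<Sum>x\<in>U. poly v (inverse x) * poly c x) = 0" by (intro sum.neutral ballI)
      then have "of_nat n * (\<Sum>i<n. coeff v i * coeff c i) = 0"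
        using v c parseval[of v c] by (simp add: vanishing_words_def words_iff)
      then show ?thesis using n_neq_0 by simp
    qed
    then show "v \<in> dual_code K n ?C" using v by (auto simp: dual_code_def vanishing_words_def)
  }
qed

text \<open>The complement requires backward closure of \<open>S\<close> as well: the injective
  power map sends the finite set \<open>S\<close> onto itself, so \<open>x ^ s \<in> S\<close>
  forces \<open>x \<in> S\<close>.\<close>

lemma root_poly_dual_zeros_over_K:
  assumes "S \<subseteq> U" "root_poly S \<in> poly_over K"
  shows "root_poly (dual_zeros S) \<in> poly_over K"
proof -
  have fin: "finite S" using assms finite_U finite_subset by blast
  have closed: "\<forall>x\<in>S. x ^ s \<in> S" using assms root_poly_over_K_iff[OF fin] by blast
  have "(\<lambda>x. x ^ s) ` S = S"
    using closed fin by (intro card_seteq) (auto simp: card_image inj_on_def pow_s_inject)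
  then have "x \<in> S" if "x ^ s \<in> S" for x
    using that by (metis (no_types, lifting) imageE pow_s_inject)
  then show ?thesis
    using finite_U
    by (subst root_poly_over_K_iff) (auto simp: dual_zeros_def pow_in_U simp flip: power_inverse)
qed

lemma vanishing_words_Int:
  "vanishing_words K n S \<inter> vanishing_words K n T = vanishing_words K n (S \<union> T)"
  by (auto simp: vanishing_words_def)

text \<open>The intersection with the dual has zero set \<open>S \<union> dual_zeros S\<close>. If
  this set is not all of \<open>U\<close>, its root polynomial is a nonzero common word.\<close>

lemma LCD_code_root_poly_iff:
  assumes "S \<subseteq> U" "root_poly S \<in> poly_over K"
  shows "LCD_code K n (cyclic_code K n (root_poly S)) \<longleftrightarrow> (\<forall>x\<in>S. inverse x \<in> S)"
proof -
  let ?W = "S \<union> dual_zeros S"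
  have fin: "finite S" using assms finite_U finite_subset by blast
  have fin': "finite (dual_zeros S)" using finite_U by (auto simp: dual_zeros_def)
  have sub: "?W \<subseteq> U" using assms by (auto simp: dual_zeros_def)
  have "root_poly ?W \<in> poly_over K"
    using assms root_poly_dual_zeros_over_K[OF assms] fin fin' by (auto simp: root_poly_over_K_iff)
  then have "root_poly ?W \<in> vanishing_words K n ?W" if "?W \<noteq> U"
    using that sub by (intro vanishing_words_root_poly) auto
  then have "vanishing_words K n ?W = {0} \<longleftrightarrow> ?W = U"
    using vanishing_words_U root_poly_neq_0[of ?W] by (cases "?W = U") (simp, blast)
  also have "\<dots> \<longleftrightarrow> (\<forall>x\<in>S. inverse x \<in> S)"
  proof
    assume W: "?W = U"
    show "\<forall>x\<in>S. inverse x \<in> S"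
    proof
      fix x assume "x \<in> S"
      then have "inverse x \<in> ?W" "inverse x \<notin> dual_zeros S"
        using W assms(1) by (auto simp: dual_zeros_def)
      then show "inverse x \<in> S" by blast
    qed
  next
    assume closed: "\<forall>x\<in>S. inverse x \<in> S"
    have "x \<in> ?W" if "x \<in> U" for x
    proof (cases "inverse x \<in> S")
      case True
      then have "inverse (inverse x) \<in> S" using closed by blast
      then show ?thesis by simp
    qed (use that in \<open>simp add: dual_zeros_def\<close>)
    then show "?W = U" using sub by blast
  qed
  finally show ?thesis
    unfolding LCD_code_def dual_code_root_poly[OF assms]
    unfolding cyclic_code_root_poly[OF assms] vanishing_words_Int .
qed

text \<open>A nonempty \<open>S\<close> makes \<open>dual_zeros S\<close> a proper subset of
  \<open>U\<close>, so inclusion of the codes can be read off from the zero sets.\<close>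

lemma self_orthogonal_root_poly_iff:
  assumes "S \<subseteq> U" "S \<noteq> {}" "root_poly S \<in> poly_over K"
  shows "self_orthogonal K n (cyclic_code K n (root_poly S)) \<longleftrightarrow> (\<forall>x\<in>S. inverse x \<notin> S)"
proof -
  have "dual_zeros S \<subset> U"
  proof -
    obtain x where "x \<in> S" using assms(2) by blast
    then have "inverse x \<in> U" "inverse x \<notin> dual_zeros S" using assms(1) by (auto simp: dual_zeros_def)
    moreover have "dual_zeros S \<subseteq> U" by (auto simp: dual_zeros_def)
    ultimately show ?thesis by blast
  qed
  then have "vanishing_words K n (dual_zeros S) \<subseteq> vanishing_words K n S \<longleftrightarrow> S \<subseteq> dual_zeros S"
    using assms by (intro vanishing_words_mono_iff root_poly_dual_zeros_over_K) auto
  also have "\<dots> \<longleftrightarrow> (\<forall>x\<in>S. inverse x \<notin> S)" using assms(1) by (auto simp: dual_zeros_def)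
  finally show ?thesis
    unfolding self_orthogonal_def dual_code_root_poly[OF assms(1,3)]
    unfolding cyclic_code_root_poly[OF assms(1,3)] by blast
qed

end

section \<open>Jacobi symbols of square-free moduli\<close>

lemma Legendre_cases: "Legendre a p = 0 \<or> Legendre a p = 1 \<or> Legendre a p = -1"
  by (simp add: Legendre_def)

lemma Legendre_eq_0_iff: "Legendre a p = 0 \<longleftrightarrow> p dvd a"
  by (simp add: Legendre_def cong_0_iff)

lemma Legendre_cong:
  assumes "[a = b] (mod p)"
  shows "Legendre a p = Legendre b p"
proof -
  have "[a = c] (mod p) \<longleftrightarrow> [b = c] (mod p)" "[c = a] (mod p) \<longleftrightarrow> [c = b] (mod p)" for c
    using assms by (auto simp: cong_def)
  then show ?thesis by (simp add: Legendre_def QuadRes_def)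
qed

lemma Legendre_1 [simp]: "p > 1 \<Longrightarrow> Legendre 1 p = 1"
proof -
  assume "p > 1"
  moreover have "QuadRes p 1" unfolding QuadRes_def by (rule exI[of _ 1]) simp
  ultimately show ?thesis by (auto simp: Legendre_def cong_0_iff zdvd_not_zless)
qed

text \<open>Euler's criterion gives the congruence modulo \<open>p\<close>. Both sides lie in
  \<open>{-1, 0, 1}\<close>, so they differ by at most 2, which is less than
  \<open>p\<close>.\<close>

lemma Legendre_mult:
  assumes "prime p" "odd p"
  shows "Legendre (a * b) (int p) = Legendre a (int p) * Legendre b (int p)"
proof -
  have "p > 2" using assms prime_ge_2_nat[of p] by (cases "p = 2") auto
  note euler = euler_criterion[OF \<open>prime p\<close> this]
  let ?L = "Legendre (a * b) (int p)" and ?R = "Legendre a (int p) * Legendre b (int p)"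
  have "[?R = a ^ ((p - 1) div 2) * b ^ ((p - 1) div 2)] (mod int p)"
    by (intro cong_mult euler)
  then have "[?L = ?R] (mod int p)"
    using euler[of "a * b"] by (metis cong_sym cong_trans power_mult_distrib)
  then have dvd: "int p dvd ?L - ?R" by (simp add: cong_iff_dvd_diff)
  have "\<bar>?L - ?R\<bar> \<le> 2"
    using Legendre_cases[of "a * b" "int p"] Legendre_cases[of a "int p"]
      Legendre_cases[of b "int p"] by auto
  then have "\<bar>?L - ?R\<bar> < int p" using \<open>p > 2\<close> by linarith
  then show ?thesis using dvd dvd_imp_le_int[of "?L - ?R" "int p"] by fastforce
qed

text \<open>Squaring maps the nonzero residues to themselves but identifies \<open>1\<close> and
  \<open>p - 1\<close>; on a finite set, failing injectivity means failing surjectivity.\<close>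

lemma ex_nonresidue:
  assumes "prime p" "odd p"
  obtains u :: nat where "Legendre (int u) (int p) = -1"
proof -
  have "p > 2" using assms prime_ge_2_nat[of p] by (cases "p = 2") auto
  define f where "f x = x ^ 2 mod p" for x :: nat
  have "f ` {1..<p} \<subseteq> {1..<p}"
  proof
    fix y assume "y \<in> f ` {1..<p}"
    then obtain x where x: "x \<in> {1..<p}" "y = x ^ 2 mod p" by (auto simp: f_def)
    have "\<not> p dvd x" using x by (auto dest: dvd_imp_le)
    then have "\<not> p dvd x ^ 2" using assms prime_dvd_power by blast
    then show "y \<in> {1..<p}" using x \<open>p > 2\<close> by (auto simp: Suc_le_eq dvd_eq_mod_eq_0)
  qed
  moreover have "\<not> inj_on f {1..<p}"
  proof
    assume inj: "inj_on f {1..<p}"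
    have "(p - 1) ^ 2 = 1 + p * (p - 2)"
    proof -
      obtain m where "p = m + 2" using \<open>p > 2\<close> by (metis add.commute le_Suc_ex less_imp_le)
      then show ?thesis by (simp add: power2_eq_square algebra_simps)
    qed
    then have "f (p - 1) = f 1" unfolding f_def by (simp only: mod_mult_self2 power_one)
    moreover have "p - 1 \<in> {1..<p}" "1 \<in> {1..<p}" "p - 1 \<noteq> 1" using \<open>p > 2\<close> by auto
    ultimately show False using inj_onD[OF inj] by blast
  qed
  ultimately have "f ` {1..<p} \<noteq> {1..<p}"
    using eq_card_imp_inj_on[of "{1..<p}" f] by auto
  then obtain u where u: "u \<in> {1..<p}" "u \<notin> f ` {1..<p}"
    using \<open>f ` {1..<p} \<subseteq> {1..<p}\<close> by blast
  have ndvd: "\<not> int p dvd int u" using u by (auto dest: dvd_imp_le)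
  have "\<not> QuadRes (int p) (int u)"
  proof
    assume "QuadRes (int p) (int u)"
    then obtain y where y: "[y ^ 2 = int u] (mod int p)" by (auto simp: QuadRes_def)
    define x where "x = nat (y mod int p)"
    have x: "int x = y mod int p" using \<open>p > 2\<close> by (simp add: x_def)
    have "[int x ^ 2 = int u] (mod int p)"
      using y by (simp add: x cong_def power_mod)
    then have "[x ^ 2 = u] (mod p)" by (metis cong_int_iff of_nat_power)
    then have "f x = u" using u by (simp add: f_def cong_def)
    moreover have "int x < int p" using \<open>p > 2\<close> unfolding x by simp
    moreover have "x \<noteq> 0" using \<open>f x = u\<close> u by (auto simp: f_def)
    ultimately show False using u by force
  qed
  then have "Legendre (int u) (int p) = -1"
    using ndvd by (simp add: Legendre_def cong_0_iff)
  then show ?thesis by (rule that)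
qed

section \<open>Divisors of a square-free number as sets of primes\<close>

lemma squarefree_prime_factorization:
  assumes "squarefree (m :: nat)"
  shows "prime_factorization m = mset_set (prime_factors m)"
proof (rule multiset_eqI)
  have "m \<noteq> 0" using assms by (metis not_squarefree_0)
  then show "count (prime_factorization m) p = count (mset_set (prime_factors m)) p" for p
    using assms squarefree_factorial_semiring'[of m]
    by (cases "p \<in> prime_factors m")
      (auto simp: count_prime_factorization in_prime_factors_iff not_in_iff
        not_dvd_imp_multiplicity_0)
qed

lemma squarefree_prod_prime_factors:
  assumes "squarefree (m :: nat)"
  shows "\<Prod>(prime_factors m) = m"
proof -
  have "m \<noteq> 0" using assms by (metis not_squarefree_0)
  then have "m = prod_mset (mset_set (prime_factors m))"
    using squarefree_prime_factorization[OF assms] prod_mset_prime_factorization_nat[of m] by simp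
  then show ?thesis by (simp add: prod_unfold_prod_mset)
qed

lemma prime_factors_prod_primes:
  fixes T :: "nat set"
  assumes "finite T" "\<And>p. p \<in> T \<Longrightarrow> prime p"
  shows "prime_factors (\<Prod>T) = T"
proof -
  have "prime_factorization (prod_mset (mset_set T)) = mset_set T"
    by (rule prime_factorization_prod_mset_primes) (use assms in auto)
  then show ?thesis using assms by (simp add: prod_unfold_prod_mset)
qed

lemma squarefree_prod_primes:
  fixes T :: "nat set"
  assumes "finite T" "\<And>p. p \<in> T \<Longrightarrow> prime p"
  shows "squarefree (\<Prod>T)"
  using assms
  by (intro squarefree_prod_coprime) (auto simp: squarefree_prime primes_coprime)

lemma bij_betw_prime_factors_divisors:
  assumes "squarefree (m :: nat)"
  shows "bij_betw prime_factors {d. d dvd m} (Pow (prime_factors m))"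
proof (rule bij_betwI[where g = "\<lambda>T. \<Prod>T"])
  have m: "m \<noteq> 0" using assms by (metis not_squarefree_0)
  show "prime_factors \<in> {d. d dvd m} \<rightarrow> Pow (prime_factors m)"
    using m dvd_prime_factors[of m] by (intro Pi_I PowI) simp
  show "(\<lambda>T. \<Prod>T) \<in> Pow (prime_factors m) \<rightarrow> {d. d dvd m}"
  proof
    fix T assume "T \<in> Pow (prime_factors m)"
    then have "\<Prod>T dvd \<Prod>(prime_factors m)" by (intro prod_dvd_prod_subset) auto
    then show "\<Prod>T \<in> {d. d dvd m}" by (simp add: squarefree_prod_prime_factors[OF assms])
  qed
  show "\<Prod>(prime_factors d) = d" if "d \<in> {d. d dvd m}" for d
    using that assms squarefree_mono squarefree_prod_prime_factors by blast
  show "prime_factors (\<Prod>T) = T" if "T \<in> Pow (prime_factors m)" for T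
    using that by (intro prime_factors_prod_primes) (auto intro: finite_subset)
qed

lemma card_divisors_prime_factors:
  assumes "squarefree (m :: nat)"
  shows "card {d. d dvd m \<and> P (prime_factors d)} = card {T. T \<subseteq> prime_factors m \<and> P T}"
proof -
  have "bij_betw prime_factors {d \<in> {d. d dvd m}. P (prime_factors d)} {T \<in> Pow (prime_factors m). P T}"
    by (rule bij_betw_Collect[OF bij_betw_prime_factors_divisors[OF assms]]) auto
  from bij_betw_same_card[OF this] show ?thesis by simp
qed

section \<open>Jacobi symbols\<close>

lemma Jacobi_squarefree:
  "squarefree Q \<Longrightarrow> Jacobi a Q = (\<Prod>p\<in>prime_factors Q. Legendre a (int p))"
  unfolding Jacobi_def by (subst squarefree_prime_factorization) (simp_all add: prod_unfold_prod_mset)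

lemma Jacobi_prime: "prime p \<Longrightarrow> Jacobi a p = Legendre a (int p)"
  by (simp add: Jacobi_def prime_factorization_prime)

lemma Jacobi_mult:
  assumes "odd Q"
  shows "Jacobi (a * b) Q = Jacobi a Q * Jacobi b Q"
proof -
  have "odd p" if "p \<in># prime_factorization Q" for p
    using that assms by (meson dvd_trans in_prime_factors_imp_dvd)
  then have "image_mset (\<lambda>p. Legendre (a * b) (int p)) (prime_factorization Q) =
      image_mset (\<lambda>p. Legendre a (int p) * Legendre b (int p)) (prime_factorization Q)"
    by (intro image_mset_cong Legendre_mult) auto
  then show ?thesis by (simp add: Jacobi_def prod_mset.distrib)
qed

lemma Jacobi_cong:
  assumes "[a = b] (mod int Q)"
  shows "Jacobi a Q = Jacobi b Q"
proof -
  have "image_mset (\<lambda>p. Legendre a (int p)) (prime_factorization Q) =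
      image_mset (\<lambda>p. Legendre b (int p)) (prime_factorization Q)"
    by (intro image_mset_cong Legendre_cong cong_dvd_modulus[OF assms]) auto
  then show ?thesis by (simp add: Jacobi_def)
qed

lemma prod_mset_pm1:
  "(\<And>x. x \<in># A \<Longrightarrow> x = 1 \<or> x = -1) \<Longrightarrow> prod_mset A = 1 \<or> prod_mset A = (-1 :: int)"
proof (induction A)
  case (add x A)
  then have "x = 1 \<or> x = -1" "prod_mset A = 1 \<or> prod_mset A = -1" by auto
  then show ?case by auto
qed auto

lemma Jacobi_coprime:
  assumes "coprime a Q"
  shows "Jacobi (int a) Q = 1 \<or> Jacobi (int a) Q = -1"
proof -
  have "Legendre (int a) (int p) = 1 \<or> Legendre (int a) (int p) = -1"
    if "p \<in># prime_factorization Q" for p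
  proof -
    have "\<not> p dvd a"
      using that assms by (metis coprime_common_divisor in_prime_factors_iff not_prime_unit)
    then have "Legendre (int a) (int p) \<noteq> 0" by (simp add: Legendre_eq_0_iff)
    then show ?thesis using Legendre_cases by blast
  qed
  then show ?thesis unfolding Jacobi_def by (intro prod_mset_pm1) auto
qed

text \<open>The Chinese remainder theorem combines a nonresidue modulo \<open>l\<close> with 1
  modulo \<open>n div l\<close>; square-freeness makes the two moduli coprime.\<close>

lemma ex_Legendre_twist:
  assumes "squarefree n" "odd n" "l \<in> prime_factors n"
  obtains u :: nat where "coprime u n" "\<And>p. p \<in> prime_factors n \<Longrightarrow>
    Legendre (int u) (int p) = (if p = l then -1 else 1)"
proof -
  have l: "prime l" "l dvd n" using assms by (auto simp: in_prime_factors_iff)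
  have "odd l" using l assms by (meson dvd_trans)
  then obtain a :: nat where a: "Legendre (int a) (int l) = -1" using l ex_nonresidue by blast
  have n: "n = l * (n div l)" using l by simp
  have "coprime l (n div l)"
  proof (rule ccontr)
    assume "\<not> coprime l (n div l)"
    then have "l dvd n div l" using l prime_imp_coprime by blast
    then have "l * l dvd n" by (subst n) (rule mult_dvd_mono, auto)
    then have "l dvd 1" using assms by (auto simp: squarefree_def power2_eq_square)
    then show False using l by auto
  qed
  then obtain u where u: "[u = a] (mod l)" "[u = 1] (mod (n div l))"
    using binary_chinese_remainder_nat by blast
  have leg: "Legendre (int u) (int p) = (if p = l then -1 else 1)" if p: "p \<in> prime_factors n" for p
  proof (cases "p = l")
    case True
    then show ?thesis using u a Legendre_cong[of "int u" "int a" "int l"] by (simp add: cong_int_iff)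
  next
    case False
    have "prime p" "p dvd l * (n div l)" using p n by (auto simp: in_prime_factors_iff)
    then have "p dvd n div l" using False l by (metis prime_dvd_mult_iff primes_dvd_imp_eq)
    then have "[u = 1] (mod p)" using u(2) cong_dvd_modulus_nat by blast
    then have "[int u = 1] (mod int p)" by (metis cong_int_iff of_nat_1)
    then show ?thesis using False prime_gt_1_nat[OF \<open>prime p\<close>] Legendre_cong[of "int u" 1 "int p"] by simp
  qed
  \<comment> \<open>A common prime factor would make one of the symbols just computed equal to
    0.\<close>
  have "coprime u n"
  proof (rule ccontr)
    assume "\<not> coprime u n"
    then have "gcd u n \<noteq> 1" using coprime_iff_gcd_eq_1 by blast
    then obtain p where "prime p" "p dvd gcd u n" using prime_factor_nat by blast
    then have "prime p" "p dvd u" "p dvd n" by auto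
    moreover have "n \<noteq> 0" using assms by (metis not_squarefree_0)
    ultimately have "Legendre (int u) (int p) \<noteq> 0" using leg[of p] by (auto simp: in_prime_factors_iff)
    then show False using \<open>p dvd u\<close> by (simp add: Legendre_eq_0_iff)
  qed
  then show ?thesis using leg by (rule that)
qed

section \<open>Zero sets of QR codes\<close>

locale odd_squarefree =
  fixes n :: nat
  assumes squarefree_n: "squarefree n" and odd_n: "odd n" and n_gt_1: "n > 1"
begin

text \<open>All levels \<open>A_set p g r\<close> with \<open>r < g\<close> taken together. Leaving
  out \<open>n\<close> leaves out the exponent 0, since \<open>gcd 0 n = n\<close>; thus 1 is never
  a zero of a generator.\<close>

definition D :: "nat set" where "D = {d. d dvd n \<and> d \<noteq> n}"

definition valid :: "(nat \<Rightarrow> nat) \<Rightarrow> (nat \<Rightarrow> int) \<Rightarrow> bool" where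
  "valid Q e \<longleftrightarrow> (\<forall>d\<in>D. Q d \<in> M_star n d \<and> e d \<in> {1, -1})"

definition Z :: "(nat \<Rightarrow> nat) \<Rightarrow> (nat \<Rightarrow> int) \<Rightarrow> nat set" where
  "Z Q e = (\<Union>d\<in>D. M_eps n d (Q d) (e d))"

lemma finite_D: "finite D"
  unfolding D_def by (rule finite_subset[of _ "{..n}"]) (use n_gt_1 in \<open>auto dest: dvd_imp_le\<close>)

lemma M_set_iff: "d \<in> D \<Longrightarrow> j \<in> M_set n d \<longleftrightarrow> j < n \<and> gcd j n = d"
  using n_gt_1 by (auto simp: M_set_def D_def Suc_le_eq intro!: gr0I)

lemma mem_Z_iff: "j \<in> Z Q e \<longleftrightarrow> j < n \<and> gcd j n \<in> D \<and> Jacobi (int j) (Q (gcd j n)) = e (gcd j n)"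
  by (auto simp: Z_def M_eps_def M_set_iff)

lemma Z_subset: "Z Q e \<subseteq> {0<..<n}"
  using n_gt_1 by (auto simp: mem_Z_iff D_def intro!: gr0I)

lemma finite_M_eps: "finite (M_eps n d Q' e')"
  by (rule finite_subset[of _ "{..n}"]) (auto simp: M_eps_def M_set_def)

lemma M_star_dvd: "d \<in> D \<Longrightarrow> Q \<in> M_star n d \<Longrightarrow> Q dvd n"
  unfolding M_star_def D_def by (auto intro: dvd_trans elim!: dvdE)

text \<open>A prime dividing both \<open>j\<close> and \<open>Q\<close> would divide
  \<open>d\<close> and \<open>n div d\<close>, so its square would divide \<open>n\<close>. Hence
  the Jacobi symbols on a layer are never 0.\<close>

lemma M_star_coprime:
  assumes "d \<in> D" "Q \<in> M_star n d" "gcd j n = d"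
  shows "coprime j Q"
proof (rule ccontr)
  assume "\<not> coprime j Q"
  then have "gcd j Q \<noteq> 1" using coprime_iff_gcd_eq_1 by blast
  then obtain l where l: "prime l" "l dvd gcd j Q" using prime_factor_nat by blast
  then have "l dvd n div d" using assms(2) by (auto simp: M_star_def intro: dvd_trans)
  moreover have "l dvd d"
    using l M_star_dvd[OF assms(1,2)] assms(3) by (metis dvd_trans gcd_greatest gcd_dvd1 gcd_dvd2)
  ultimately have "l * l dvd d * (n div d)" by (intro mult_dvd_mono)
  then have "l ^ 2 dvd n" using assms(1) by (simp add: D_def power2_eq_square)
  then show False using l squarefreeD[OF squarefree_n] not_prime_unit by blast
qed

lemma odd_if_dvd: "Q dvd n \<Longrightarrow> odd Q"
  using odd_n dvd_trans by blast

section \<open>Multiplication by units on the exponents of the zeros\<close>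

lemma Jacobi_mult_mod:
  assumes "Q dvd n"
  shows "Jacobi (int (a * j mod n)) Q = Jacobi (int a) Q * Jacobi (int j) Q"
proof -
  have "[a * j mod n = a * j] (mod Q)" using assms by (simp add: cong_def mod_mod_cancel)
  then have "[int (a * j mod n) = int a * int j] (mod int Q)" by (metis cong_int_iff of_nat_mult)
  then show ?thesis using Jacobi_cong Jacobi_mult[OF odd_if_dvd[OF assms]] by metis
qed

lemma gcd_mult_mod: "coprime a n \<Longrightarrow> gcd (a * j mod n) n = gcd j n"
  by (metis coprime_commute gcd.commute gcd_mult_left_left_cancel gcd_red_nat)

lemma ex_twist:
  assumes "Q dvd n" "l \<in> prime_factors Q"
  obtains u where "coprime u n" "Jacobi (int u) Q = -1"
    "\<And>Q'. Q' dvd n \<Longrightarrow> l \<notin> prime_factors Q' \<Longrightarrow> Jacobi (int u) Q' = 1"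
proof -
  have sub: "prime_factors Q' \<subseteq> prime_factors n" if "Q' dvd n" for Q'
    using that n_gt_1 dvd_prime_factors[of n Q'] by simp
  have sf: "squarefree Q'" if "Q' dvd n" for Q'
    using that squarefree_n squarefree_mono by blast
  have "l \<in> prime_factors n" using sub assms by blast
  then obtain u where u: "coprime u n" "\<And>p. p \<in> prime_factors n \<Longrightarrow>
    Legendre (int u) (int p) = (if p = l then -1 else 1)"
    using ex_Legendre_twist[OF squarefree_n odd_n] by blast
  have J: "Jacobi (int u) Q' = (\<Prod>p\<in>prime_factors Q'. if p = l then -1 else 1)" if "Q' dvd n" for Q'
    unfolding Jacobi_squarefree[OF sf[OF that]]
    by (rule prod.cong[OF refl]) (use u sub[OF that] in blast)
  show ?thesis
  proof (rule that[OF u(1)])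
    show "Jacobi (int u) Q = -1" using assms by (simp add: J)
    show "Jacobi (int u) Q' = 1" if "Q' dvd n" "l \<notin> prime_factors Q'" for Q'
      using that by (simp add: J)
  qed
qed

lemma M_star_prime_factor: "Q \<in> M_star n d \<Longrightarrow> \<exists>l. l \<in> prime_factors Q"
  unfolding M_star_def by (metis (mono_tags, lifting) in_prime_factors_iff mem_Collect_eq not_one_less_zero prime_factor_nat less_irrefl)

text \<open>The divisor \<open>d\<close> lies in its own layer; if its symbol has the wrong sign,
  multiplication by a twist at a prime of \<open>Q\<close> corrects it.\<close>

lemma M_eps_nonempty:
  assumes "d \<in> D" "Q \<in> M_star n d" "e \<in> {1, -1}"
  obtains j where "j < n" "gcd j n = d" "Jacobi (int j) Q = e"
proof -
  have dvd: "Q dvd n" using M_star_dvd assms by blast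
  have d: "d < n" "gcd d n = d" using assms(1) n_gt_1 by (auto simp: D_def gcd_nat.absorb1 dest: dvd_imp_le
    intro: le_neq_implies_less)
  have J: "Jacobi (int d) Q = 1 \<or> Jacobi (int d) Q = -1"
    using M_star_coprime[OF assms(1,2) d(2)] by (rule Jacobi_coprime)
  show ?thesis
  proof (cases "Jacobi (int d) Q = e")
    case True
    then show ?thesis using that d by blast
  next
    case False
    obtain l where "l \<in> prime_factors Q" using assms M_star_prime_factor by blast
    then obtain u where u: "coprime u n" "Jacobi (int u) Q = -1" using ex_twist[OF dvd] by metis
    have "u * d mod n < n" using n_gt_1 by simp
    moreover have "gcd (u * d mod n) n = d" using gcd_mult_mod[OF u(1)] d by simp
    moreover have "Jacobi (int (u * d mod n)) Q = e"
      using Jacobi_mult_mod[OF dvd] u(2) J False assms(3) by auto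
    ultimately show ?thesis using that by blast
  qed
qed

lemma valid_nonempty:
  assumes "valid Q e" "d \<in> D"
  obtains j where "j \<in> Z Q e" "gcd j n = d"
proof -
  obtain j where "j < n" "gcd j n = d" "Jacobi (int j) (Q d) = e d"
    using assms M_eps_nonempty[of d "Q d" "e d"] by (auto simp: valid_def)
  then show ?thesis using that assms by (auto simp: mem_Z_iff)
qed

text \<open>A unit \<open>a\<close> keeps \<open>j\<close> in its layer and multiplies its symbol by
  that of \<open>a\<close>; the sign \<open>e\<close> is nonzero and cancels.\<close>

lemma mult_mod_mem_Z_iff:
  assumes "valid Q e" "coprime a n" "j \<in> Z Q e"
  shows "a * j mod n \<in> Z Q e \<longleftrightarrow> Jacobi (int a) (Q (gcd j n)) = 1"
proof -
  let ?d = "gcd j n"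
  have j: "?d \<in> D" "Jacobi (int j) (Q ?d) = e ?d" using assms by (auto simp: mem_Z_iff)
  have Q: "Q ?d dvd n" "e ?d \<noteq> 0" using assms j M_star_dvd by (auto simp: valid_def)
  have "a * j mod n \<in> Z Q e \<longleftrightarrow> Jacobi (int a) (Q ?d) * e ?d = e ?d"
    using j n_gt_1 by (simp add: mem_Z_iff gcd_mult_mod[OF assms(2)] Jacobi_mult_mod[OF Q(1)])
  then show ?thesis using Q by simp
qed

text \<open>Every layer meets \<open>Z Q e\<close>, so the condition is tested at each
  \<open>d\<close>.\<close>

lemma Z_mult_closed_iff:
  assumes "valid Q e" "coprime a n"
  shows "(\<forall>j\<in>Z Q e. a * j mod n \<in> Z Q e) \<longleftrightarrow> (\<forall>d\<in>D. Jacobi (int a) (Q d) = 1)"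
  using mult_mod_mem_Z_iff[OF assms] valid_nonempty[OF assms(1)] by (metis mem_Z_iff)

lemma Z_mult_disjoint_iff:
  assumes "valid Q e" "coprime a n"
  shows "(\<forall>j\<in>Z Q e. a * j mod n \<notin> Z Q e) \<longleftrightarrow> (\<forall>d\<in>D. Jacobi (int a) (Q d) = -1)"
proof -
  have "Jacobi (int a) (Q d) = 1 \<or> Jacobi (int a) (Q d) = -1" if "d \<in> D" for d
    using that assms M_star_dvd[OF that, of "Q d"] coprime_divisors[of a a "Q d" n]
    by (intro Jacobi_coprime) (auto simp: valid_def)
  then have "(\<forall>d\<in>D. Jacobi (int a) (Q d) = -1) \<longleftrightarrow> (\<forall>d\<in>D. Jacobi (int a) (Q d) \<noteq> 1)" by force
  then show ?thesis using mult_mod_mem_Z_iff[OF assms] valid_nonempty[OF assms(1)]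
    by (metis mem_Z_iff)
qed

text \<open>
  Multiplication by a twist \<open>u\<close> at a prime \<open>l\<close> dividing \<open>Q d\<close> but not \<open>Q' d\<close> moves an element of
  \<open>Z Q e\<close> out of \<open>Z Q e\<close> while it preserves \<open>Z Q' e'\<close> on the layer of \<open>d\<close>.
\<close>

lemma Z_eq_imp_prime_factors_subset:
  assumes "valid Q e" "valid Q' e'" "Z Q e = Z Q' e'" "d \<in> D"
  shows "prime_factors (Q d) \<subseteq> prime_factors (Q' d)"
proof (rule ccontr)
  assume "\<not> ?thesis"
  then obtain l where l: "l \<in> prime_factors (Q d)" "l \<notin> prime_factors (Q' d)" by blast
  have dvd: "Q d dvd n" "Q' d dvd n" using assms M_star_dvd by (auto simp: valid_def)
  obtain u where u: "coprime u n" "Jacobi (int u) (Q d) = -1"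
    "\<And>Q'. Q' dvd n \<Longrightarrow> l \<notin> prime_factors Q' \<Longrightarrow> Jacobi (int u) Q' = 1"
    using ex_twist[OF dvd(1) l(1)] by blast
  obtain j where j: "j \<in> Z Q e" "gcd j n = d" using valid_nonempty[OF assms(1,4)] .
  have "u * j mod n \<notin> Z Q e" using mult_mod_mem_Z_iff[OF assms(1) u(1) j(1)] u(2) j(2) by simp
  moreover have "u * j mod n \<in> Z Q' e'"
    using mult_mod_mem_Z_iff[OF assms(2) u(1), of j] u(3)[OF dvd(2) l(2)] j assms(3) by simp
  ultimately show False using assms(3) by simp
qed

text \<open>The inclusion used in both directions yields equal sets of primes, which determine the
  square-free \<open>Q d\<close>; a common exponent in the layer then fixes the sign.\<close>

lemma Z_eq_imp:
  assumes "valid Q e" "valid Q' e'" "Z Q e = Z Q' e'" "d \<in> D"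
  shows "Q d = Q' d \<and> e d = e' d"
proof -
  have "prime_factors (Q d) = prime_factors (Q' d)"
    using Z_eq_imp_prime_factors_subset assms by (intro equalityI) metis+
  moreover have "squarefree (Q d)" "squarefree (Q' d)"
    using assms M_star_dvd squarefree_mono[OF _ squarefree_n] unfolding valid_def by blast+
  ultimately have "Q d = Q' d" using squarefree_prod_prime_factors by metis
  moreover obtain j where j: "j \<in> Z Q e" "gcd j n = d" using valid_nonempty[OF assms(1,4)] .
  moreover have "j \<in> Z Q' e'" using j assms by simp
  ultimately show ?thesis by (simp add: mem_Z_iff)
qed

lemma Z_cong: "(\<And>d. d \<in> D \<Longrightarrow> Q d = Q' d \<and> e d = e' d) \<Longrightarrow> Z Q e = Z Q' e'"
  by (auto simp: Z_def)

lemma prod_F_poly: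
  assumes "inj_on (\<lambda>j. \<theta> ^ j) {..<n}"
  shows "(\<Prod>d\<in>D. F_poly n \<theta> d (Q d) (e d)) = (\<Prod>x\<in>(\<lambda>j. \<theta> ^ j) ` Z Q e. [:- x, 1:])"
proof -
  have "(\<Prod>d\<in>D. F_poly n \<theta> d (Q d) (e d)) = (\<Prod>j\<in>Z Q e. [:- (\<theta> ^ j), 1:])"
    unfolding F_poly_def Z_def
    by (rule prod.UNION_disjoint[symmetric])
      (auto simp: finite_D finite_M_eps M_eps_def M_set_def)
  moreover have "inj_on (\<lambda>j. \<theta> ^ j) (Z Q e)"
    using assms by (rule inj_on_subset) (use Z_subset in force)
  ultimately show ?thesis by (simp add: prod.reindex)
qed

section \<open>Counting the choices in each layer\<close>

lemma n_div_prime_in_D: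
  assumes "l \<in> prime_factors n"
  shows "n div l \<in> D" "M_star n (n div l) = {l}"
proof -
  have l: "prime l" "l dvd n" using assms by (auto simp: in_prime_factors_iff)
  show "n div l \<in> D" using l n_gt_1 prime_gt_1_nat[of l] by (auto simp: D_def)
  have "n div (n div l) = l" using l n_gt_1 by (simp add: div_div_eq_right)
  then show "M_star n (n div l) = {l}"
    using l by (auto simp: M_star_def prime_nat_iff)
qed

lemma div_D_pos: "d \<in> D \<Longrightarrow> n div d > 0"
  using n_gt_1 by (auto simp: D_def intro!: gr0I elim!: dvdE)

lemma M_star_eq: "d \<in> D \<Longrightarrow> M_star n d = {Q. Q dvd n div d \<and> prime_factors Q \<noteq> {}}"
proof -
  assume "d \<in> D"
  then have "n div d > 0" by (rule div_D_pos)
  then have "Q > 0" if "Q dvd n div d" for Q using that by (auto intro!: gr0I)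
  moreover have "prime_factors Q \<noteq> {} \<longleftrightarrow> Q > 1" if "Q > 0" for Q :: nat
    using that by (auto simp: prime_factorization_empty_iff)
  ultimately show ?thesis by (auto simp: M_star_def)
qed

lemma squarefree_div: "d \<in> D \<Longrightarrow> squarefree (n div d)"
  using squarefree_n by (rule squarefree_mono[rotated]) (auto simp: D_def elim!: dvdE)

lemma card_prime_factors_div:
  assumes "d \<in> D"
  shows "card (prime_factors (n div d)) = card (prime_factors n) - card (prime_factors d)"
    "card (prime_factors d) < card (prime_factors n)"
proof -
  have d: "d dvd n" "d \<noteq> n" using assms by (auto simp: D_def)
  have sub: "prime_factors d \<subseteq> prime_factors n" using d n_gt_1 dvd_prime_factors[of n d] by simp
  have "prime_factors d \<noteq> prime_factors n"
    using d squarefree_prod_prime_factors[OF squarefree_n]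
      squarefree_prod_prime_factors[OF squarefree_mono[OF d(1) squarefree_n]] by metis
  then show "card (prime_factors d) < card (prime_factors n)"
    using sub by (intro psubset_card_mono) auto
  have "prime_factorization n = prime_factorization d + prime_factorization (n div d)"
    using d n_gt_1 div_D_pos[OF assms] prime_factorization_mult[of d "n div d"] by auto
  then have "size (prime_factorization n) = size (prime_factorization d) + size (prime_factorization (n div d))"
    by simp
  then show "card (prime_factors (n div d)) = card (prime_factors n) - card (prime_factors d)"
    using squarefree_prime_factorization[OF squarefree_n] squarefree_prime_factorization[OF squarefree_div[OF assms]]
      squarefree_prime_factorization[OF squarefree_mono[OF d(1) squarefree_n]]
    by (metis add_diff_cancel_left' size_mset_set)
qed

lemma card_M_star:
  assumes "d \<in> D"
  shows "card (M_star n d) = 2 ^ (card (prime_factors n) - card (prime_factors d)) - 1"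
proof -
  have "card (M_star n d) = card {T. T \<subseteq> prime_factors (n div d) \<and> T \<noteq> {}}"
    unfolding M_star_eq[OF assms] by (rule card_divisors_prime_factors[OF squarefree_div[OF assms]])
  also have "{T. T \<subseteq> prime_factors (n div d) \<and> T \<noteq> {}} = Pow (prime_factors (n div d)) - {{}}" by auto
  finally show ?thesis by (simp add: card_Pow card_prime_factors_div(1)[OF assms])
qed

text \<open>Half of the subsets of a nonempty set have odd size. The factor 2 avoids division and
  matches the two signs available for each \<open>Q\<close>.\<close>

lemma card_M_star_odd:
  assumes "d \<in> D"
  shows "2 * card {Q \<in> M_star n d. odd (card (prime_factors Q))} =
    2 ^ (card (prime_factors n) - card (prime_factors d))"
proof -
  let ?P = "prime_factors (n div d)"
  have "{Q \<in> M_star n d. odd (card (prime_factors Q))} = {Q. Q dvd n div d \<and> odd (card (prime_factors Q))}"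
    unfolding M_star_eq[OF assms] by (auto simp del: set_mset_eq_empty_iff)
  then have "card {Q \<in> M_star n d. odd (card (prime_factors Q))} = card {T. T \<subseteq> ?P \<and> odd (card T)}"
    using card_divisors_prime_factors[OF squarefree_div[OF assms]] by simp
  moreover have "card {T. T \<subseteq> ?P \<and> even (card T)} = card {T. T \<subseteq> ?P \<and> odd (card T)}"
  proof -
    have "{} \<subset> ?P" using card_prime_factors_div[OF assms] by (metis card.empty psubsetI empty_subsetI zero_less_diff less_irrefl)
    then show ?thesis using card_subsupersets_even_odd[of ?P "{}"] by simp
  qed
  moreover have "card {T. T \<subseteq> ?P \<and> even (card T)} + card {T. T \<subseteq> ?P \<and> odd (card T)} = card (Pow ?P)"
    by (subst card_Un_disjoint[symmetric]) (auto intro!: arg_cong[of _ _ card])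
  ultimately show ?thesis by (simp add: card_Pow card_prime_factors_div(1)[OF assms])
qed

lemma Jacobi_const:
  assumes "Q dvd n" "\<And>l. l \<in> prime_factors n \<Longrightarrow> Jacobi a l = c"
  shows "Jacobi a Q = c ^ card (prime_factors Q)"
proof -
  have "squarefree Q" using assms(1) squarefree_n squarefree_mono by blast
  moreover have "prime_factors Q \<subseteq> prime_factors n"
    using assms(1) n_gt_1 dvd_prime_factors[of n Q] by simp
  then have "(\<Prod>p\<in>prime_factors Q. Legendre a (int p)) = (\<Prod>p\<in>prime_factors Q. c)"
    using assms(2) Jacobi_prime[of _ a] by (intro prod.cong refl) (metis in_prime_factors_imp_prime subsetD)
  ultimately show ?thesis by (simp add: Jacobi_squarefree)
qed

lemma card_divisors_level:
  "card {d. d dvd n \<and> card (prime_factors d) = r} = card (prime_factors n) choose r"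
  using card_divisors_prime_factors[OF squarefree_n, of "\<lambda>T. card T = r"]
  by (simp add: n_subsets)

text \<open>The divisors are grouped by their number of primes; the top level consists of
  \<open>n\<close> alone, which \<open>D\<close> omits.\<close>

lemma prod_D:
  "(\<Prod>d\<in>D. f (card (prime_factors d))) =
    (\<Prod>r=0..card (prime_factors n) - 1. f r ^ (card (prime_factors n) choose r))"
proof -
  let ?g = "card (prime_factors n)"
  have level: "{d \<in> D. card (prime_factors d) = r} = {d. d dvd n \<and> card (prime_factors d) = r}"
    if "r \<in> {0..?g - 1}" for r
  proof -
    have "?g > 0" using card_prime_factors_div(2)[of 1] n_gt_1 by (simp add: D_def)
    then have "r \<noteq> ?g" using that by auto
    then show ?thesis by (auto simp: D_def)
  qed
  have "(\<Prod>d\<in>D. f (card (prime_factors d))) =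
      (\<Prod>r=0..?g - 1. \<Prod>d\<in>{d \<in> D. card (prime_factors d) = r}. f (card (prime_factors d)))"
    by (rule prod.group[symmetric]) (use card_prime_factors_div(2) finite_D in fastforce)+
  also have "\<dots> = (\<Prod>r=0..?g - 1. f r ^ card {d \<in> D. card (prime_factors d) = r})"
    by (intro prod.cong refl) simp
  also have "\<dots> = (\<Prod>r=0..?g - 1. f r ^ (?g choose r))"
    by (rule prod.cong[OF refl]) (simp only: level card_divisors_level)
  finally show ?thesis .
qed

end

section \<open>Counting QR codes\<close>

locale qr_code_setting = odd_squarefree n + fixed_field_code n s \<theta> K
  for n s :: nat and \<theta> :: "'a::field" and K :: "'a set" +
  assumes coprime_s_n: "coprime s n"
begin

section \<open>From exponents to zeros in the field\<close>

definition zeros :: "(nat \<Rightarrow> nat) \<Rightarrow> (nat \<Rightarrow> int) \<Rightarrow> 'a set" where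
  "zeros Q e = (\<lambda>j. \<theta> ^ j) ` Z Q e"

lemma zeros_mem_iff: "j < n \<Longrightarrow> \<theta> ^ j \<in> zeros Q e \<longleftrightarrow> j \<in> Z Q e"
  using inj_on_theta_pow Z_subset[of Q e] unfolding zeros_def
  by (subst inj_on_image_mem_iff[where B = "{..<n}"]) auto

lemma zeros_psubset_U: "zeros Q e \<subset> U"
proof -
  have "\<theta> ^ 0 \<notin> zeros Q e" using zeros_mem_iff[of 0] n_gt_1 Z_subset[of Q e] by auto
  moreover have "zeros Q e \<subseteq> U" using theta_pow_in_U by (auto simp: zeros_def)
  ultimately show ?thesis using theta_pow_in_U[of 0] by blast
qed

lemma zeros_nonempty: "valid Q e \<Longrightarrow> zeros Q e \<noteq> {}"
proof -
  assume "valid Q e"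
  moreover have "1 \<in> D" using n_gt_1 by (simp add: D_def)
  ultimately obtain j where "j \<in> Z Q e" using valid_nonempty by blast
  then show ?thesis by (auto simp: zeros_def)
qed

lemma zeros_pow_mem_iff: "(\<theta> ^ j) ^ a \<in> zeros Q e \<longleftrightarrow> a * j mod n \<in> Z Q e"
proof -
  have "(\<theta> ^ j) ^ a = \<theta> ^ (a * j mod n)" by (simp add: theta_pow_mod mult.commute flip: power_mult)
  then show ?thesis using zeros_mem_iff n_pos by simp
qed

lemma zeros_pow_closed_iff:
  "valid Q e \<Longrightarrow> coprime a n \<Longrightarrow>
    (\<forall>x\<in>zeros Q e. x ^ a \<in> zeros Q e) \<longleftrightarrow> (\<forall>d\<in>D. Jacobi (int a) (Q d) = 1)"
  using Z_mult_closed_iff[of Q e a] zeros_pow_mem_iff[of _ a Q e] by (simp add: zeros_def)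

lemma zeros_pow_disjoint_iff:
  "valid Q e \<Longrightarrow> coprime a n \<Longrightarrow>
    (\<forall>x\<in>zeros Q e. x ^ a \<notin> zeros Q e) \<longleftrightarrow> (\<forall>d\<in>D. Jacobi (int a) (Q d) = -1)"
  using Z_mult_disjoint_iff[of Q e a] zeros_pow_mem_iff[of _ a Q e] by (simp add: zeros_def)

lemma zeros_eq_imp: "zeros Q e = zeros Q' e' \<Longrightarrow> Z Q e = Z Q' e'"
proof -
  assume "zeros Q e = zeros Q' e'"
  moreover have "Z Q e \<subseteq> {..<n}" "Z Q' e' \<subseteq> {..<n}"
    using Z_subset[of Q e] Z_subset[of Q' e'] by auto
  ultimately show ?thesis
    unfolding zeros_def using inj_on_image_eq_iff[OF inj_on_theta_pow] by blast
qed

text \<open>With \<open>n - 1\<close> as the natural representative of -1, inversion is treated like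
  the map \<open>x \<mapsto> x ^ s\<close>.\<close>

lemma inverse_eq_pow: "x \<in> U \<Longrightarrow> inverse x = x ^ (n - 1)"
proof -
  assume "x \<in> U"
  then have "x * x ^ (n - 1) = 1" using n_pos by (simp add: U_def flip: power_Suc)
  then show ?thesis by (rule inverse_unique)
qed

lemma coprime_n_minus_1: "coprime (n - 1) n"
  using n_gt_1 coprime_diff_one_left_nat by simp

lemma root_poly_zeros_over_K_iff:
  assumes "valid Q e"
  shows "root_poly (zeros Q e) \<in> poly_over K \<longleftrightarrow> (\<forall>d\<in>D. Jacobi (int s) (Q d) = 1)"
  using zeros_psubset_U[of Q e] finite_U finite_subset[of "zeros Q e" U]
    zeros_pow_closed_iff[OF assms coprime_s_n] root_poly_over_K_iff by auto

section \<open>Jacobi symbol criteria for codes, and their number\<close>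

definition code :: "(nat \<Rightarrow> nat) \<Rightarrow> (nat \<Rightarrow> int) \<Rightarrow> 'a poly set" where
  "code Q e = cyclic_code K n (root_poly (zeros Q e))"

lemma LCD_code_iff:
  assumes "valid Q e" "root_poly (zeros Q e) \<in> poly_over K"
  shows "LCD_code K n (code Q e) \<longleftrightarrow> (\<forall>d\<in>D. Jacobi (int (n - 1)) (Q d) = 1)"
proof -
  have sub: "zeros Q e \<subseteq> U" using zeros_psubset_U by blast
  then have "(\<forall>x\<in>zeros Q e. inverse x \<in> zeros Q e) \<longleftrightarrow> (\<forall>x\<in>zeros Q e. x ^ (n - 1) \<in> zeros Q e)"
    using inverse_eq_pow by (metis subsetD)
  then show ?thesis
    unfolding code_def LCD_code_root_poly_iff[OF sub assms(2)]
    using zeros_pow_closed_iff[OF assms(1) coprime_n_minus_1] by simp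
qed

lemma self_orthogonal_iff:
  assumes "valid Q e" "root_poly (zeros Q e) \<in> poly_over K"
  shows "self_orthogonal K n (code Q e) \<longleftrightarrow> (\<forall>d\<in>D. Jacobi (int (n - 1)) (Q d) = -1)"
proof -
  have sub: "zeros Q e \<subseteq> U" using zeros_psubset_U by blast
  then have "(\<forall>x\<in>zeros Q e. inverse x \<notin> zeros Q e) \<longleftrightarrow> (\<forall>x\<in>zeros Q e. x ^ (n - 1) \<notin> zeros Q e)"
    using inverse_eq_pow by (metis subsetD)
  then show ?thesis
    unfolding code_def self_orthogonal_root_poly_iff[OF sub zeros_nonempty[OF assms(1)] assms(2)]
    using zeros_pow_disjoint_iff[OF assms(1) coprime_n_minus_1] by simp
qed

text \<open>The symbol of \<open>s\<close> accounts for coefficients in \<open>K\<close>. The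
  parameter \<open>c\<close> is 1 for LCD codes and -1 for self-orthogonal ones, which lets both
  counts share one argument.\<close>

definition admissible :: "int \<Rightarrow> nat \<Rightarrow> nat set" where
  "admissible c d = {Q \<in> M_star n d. Jacobi (int s) Q = 1 \<and> Jacobi (int (n - 1)) Q = c}"

definition codes :: "int \<Rightarrow> 'a poly set set" where
  "codes c = {code Q e | Q e. valid Q e \<and> (\<forall>d\<in>D. Q d \<in> admissible c d)}"

lemma code_cong: "(\<And>d. d \<in> D \<Longrightarrow> Q d = Q' d \<and> e d = e' d) \<Longrightarrow> code Q e = code Q' e'"
  using Z_cong[of Q Q' e e'] by (simp add: code_def zeros_def)

lemma codes_eqI:
  assumes "\<And>Q e. valid Q e \<Longrightarrow> root_poly (zeros Q e) \<in> poly_over K \<Longrightarrow>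
    P (code Q e) \<longleftrightarrow> (\<forall>d\<in>D. Jacobi (int (n - 1)) (Q d) = c)"
  shows "{C \<in> {code Q e | Q e. valid Q e \<and> root_poly (zeros Q e) \<in> poly_over K}. P C} = codes c"
proof -
  have "root_poly (zeros Q e) \<in> poly_over K \<and> P (code Q e) \<longleftrightarrow> (\<forall>d\<in>D. Q d \<in> admissible c d)"
    if "valid Q e" for Q e
    using assms[OF that] root_poly_zeros_over_K_iff[OF that] that
    by (auto simp: admissible_def valid_def)
  then show ?thesis unfolding codes_def by blast
qed

text \<open>Choices of pairs \<open>(Q d, e d)\<close> on \<open>D\<close> correspond bijectively to
  codes: equal codes have equal zero sets, and these determine the choice on
  \<open>D\<close>.\<close>

lemma card_codes: "card (codes c) = (\<Prod>d\<in>D. 2 * card (admissible c d))"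
proof -
  define F where "F = PiE D (\<lambda>d. admissible c d \<times> {1, -1 :: int})"
  define \<Phi> where "\<Phi> f = code (fst \<circ> f) (snd \<circ> f)" for f
  have F: "valid (fst \<circ> f) (snd \<circ> f)" "\<forall>d\<in>D. (fst \<circ> f) d \<in> admissible c d" if "f \<in> F" for f
    using that by (auto simp: F_def valid_def admissible_def PiE_iff mem_Times_iff)
  have "codes c = \<Phi> ` F"
  proof (intro equalityI subsetI)
    fix C assume "C \<in> codes c"
    then obtain Q e where C: "C = code Q e" "valid Q e" "\<forall>d\<in>D. Q d \<in> admissible c d"
      by (auto simp: codes_def)
    \<comment> \<open>Values outside \<open>D\<close> do not affect the code; restriction gives one
      representative per choice.\<close>
    let ?f = "restrict (\<lambda>d. (Q d, e d)) D"
    have "?f \<in> F" using C by (auto simp: F_def valid_def)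
    moreover have "C = \<Phi> ?f" unfolding C \<Phi>_def by (rule code_cong) simp
    ultimately show "C \<in> \<Phi> ` F" by blast
  next
    fix C assume "C \<in> \<Phi> ` F"
    then show "C \<in> codes c" using F unfolding codes_def \<Phi>_def by blast
  qed
  moreover have "inj_on \<Phi> F"
  proof (rule inj_onI)
    fix f g assume fg: "f \<in> F" "g \<in> F" "\<Phi> f = \<Phi> g"
    have over_K: "root_poly (zeros (fst \<circ> h) (snd \<circ> h)) \<in> poly_over K" if "h \<in> F" for h
      using F[OF that] root_poly_zeros_over_K_iff by (auto simp: admissible_def)
    have "zeros (fst \<circ> f) (snd \<circ> f) = zeros (fst \<circ> g) (snd \<circ> g)"
      using fg(3) cyclic_code_root_poly_eq_iff[OF zeros_psubset_U zeros_psubset_U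
          over_K[OF fg(1)] over_K[OF fg(2)]] by (simp add: \<Phi>_def code_def)
    then have "Z (fst \<circ> f) (snd \<circ> f) = Z (fst \<circ> g) (snd \<circ> g)" by (rule zeros_eq_imp)
    then have "f d = g d" if "d \<in> D" for d
      using Z_eq_imp[OF F(1)[OF fg(1)] F(1)[OF fg(2)] _ that] by (simp add: prod_eq_iff)
    then show "f = g" using fg unfolding F_def by (intro PiE_ext) auto
  qed
  ultimately have "card (codes c) = card F" by (simp add: card_image)
  also have "\<dots> = (\<Prod>d\<in>D. card (admissible c d \<times> {1, -1 :: int}))"
    unfolding F_def using finite_D by (rule card_PiE)
  finally show ?thesis by (simp add: card_cartesian_product mult_2)
qed

text \<open>
  For \<open>d = n / l\<close> with \<open>l\<close> prime, \<open>M_star n d = {l}\<close> leaves no choice, so a single code already fixes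
  all the Legendre symbols.
\<close>

lemma codes_nonempty_imp:
  assumes "card (codes c) \<noteq> 0" "Q dvd n"
  shows "Jacobi (int s) Q = 1" "Jacobi (int (n - 1)) Q = c ^ card (prime_factors Q)"
proof -
  have "Jacobi (int s) l = 1 \<and> Jacobi (int (n - 1)) l = c" if "l \<in> prime_factors n" for l
  proof -
    note l = n_div_prime_in_D[OF that]
    have "card (admissible c (n div l)) \<noteq> 0"
      using assms l(1) finite_D unfolding card_codes by simp
    then have "admissible c (n div l) \<noteq> {}" by auto
    then show ?thesis using l(2) by (auto simp: admissible_def)
  qed
  then show "Jacobi (int s) Q = 1" "Jacobi (int (n - 1)) Q = c ^ card (prime_factors Q)"
    using Jacobi_const[OF assms(2), of "int s" 1] Jacobi_const[OF assms(2), of "int (n - 1)" c]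
    by auto
qed

text \<open>Once all symbols at primes are 1, every element of \<open>M_star n d\<close> is
  admissible.\<close>

lemma card_codes_1:
  assumes "card (codes 1) \<noteq> 0"
  shows "card (codes 1) = (\<Prod>r=0..card (prime_factors n) - 1.
    (2 * (2 ^ (card (prime_factors n) - r) - 1)) ^ (card (prime_factors n) choose r))"
proof -
  have "admissible 1 d = M_star n d" if "d \<in> D" for d
    using codes_nonempty_imp[OF assms] M_star_dvd[OF that] by (auto simp: admissible_def)
  then have "card (codes 1) =
      (\<Prod>d\<in>D. 2 * (2 ^ (card (prime_factors n) - card (prime_factors d)) - 1))"
    unfolding card_codes by (intro prod.cong refl) (simp add: card_M_star)
  then show ?thesis by (simp only: prod_D[of "\<lambda>r. 2 * (2 ^ (card (prime_factors n) - r) - 1)"])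
qed

text \<open>With symbol -1 of \<open>n - 1\<close> at every prime, \<open>Q\<close> is admissible
  exactly when it has an odd number of prime factors.\<close>

lemma card_codes_minus_1:
  assumes "card (codes (-1)) \<noteq> 0"
  shows "card (codes (-1)) = (\<Prod>r=0..card (prime_factors n) - 1.
    (2 ^ (card (prime_factors n) - r)) ^ (card (prime_factors n) choose r))"
proof -
  have "admissible (-1) d = {Q \<in> M_star n d. odd (card (prime_factors Q))}" if "d \<in> D" for d
    using codes_nonempty_imp[OF assms] M_star_dvd[OF that]
    by (auto simp: admissible_def minus_one_power_iff)
  then have "card (codes (-1)) =
      (\<Prod>d\<in>D. 2 ^ (card (prime_factors n) - card (prime_factors d)))"
    unfolding card_codes by (intro prod.cong refl) (simp add: card_M_star_odd)
  then show ?thesis by (simp only: prod_D[of "\<lambda>r. 2 ^ (card (prime_factors n) - r)"])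
qed

end

section \<open>The closed form of the count, and the passage to the definitions\<close>

lemma prod_two_power_choose:
  assumes "g \<ge> 1"
  shows "(\<Prod>r=0..g - 1. (2 ^ (g - r)) ^ (g choose r)) = (2 ^ (g * 2 ^ (g - 1)) :: nat)"
proof -
  have "(\<Prod>r=0..g - 1. (2 ^ (g - r)) ^ (g choose r)) = (2 :: nat) ^ (\<Sum>r=0..g - 1. (g - r) * (g choose r))"
    by (simp add: power_sum flip: power_mult)
  \<comment> \<open>The added term at \<open>r = g\<close> is 0; the reflection
    \<open>r \<mapsto> g - r\<close> then leads to the standard sum of
    \<open>r * (g choose r)\<close>.\<close>
  also have "(\<Sum>r=0..g - 1. (g - r) * (g choose r)) = (\<Sum>r\<le>g. (g - r) * (g choose r))"
    by (rule sum.mono_neutral_left) (use assms in auto)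
  also have "\<dots> = (\<Sum>r\<le>g. r * (g choose r))"
    by (rule sum.reindex_bij_witness[of _ "\<lambda>r. g - r" "\<lambda>r. g - r"])
      (auto simp: binomial_symmetric[symmetric])
  finally show ?thesis by (simp add: choose_linear_sum)
qed

lemma A_set_eq:
  assumes inj: "inj_on p {1..g}" and pr: "\<And>i. i \<in> {1..g} \<Longrightarrow> prime (p i)"
    and n: "n = (\<Prod>i=1..g. p i)"
  shows "A_set p g r = {d. d dvd n \<and> card (prime_factors d) = r}"
proof -
  have prod: "(\<Prod>i\<in>I. p i) = \<Prod>(p ` I)" if "I \<subseteq> {1..g}" for I
    using inj_on_subset[OF inj that] by (simp add: prod.reindex)
  have pf: "prime_factors (\<Prod>i\<in>I. p i) = p ` I" if "I \<subseteq> {1..g}" for I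
    unfolding prod[OF that]
    by (rule prime_factors_prod_primes) (use that pr finite_subset[OF that] in auto)
  have card: "card (p ` I) = card I" if "I \<subseteq> {1..g}" for I
    using inj_on_subset[OF inj that] by (rule card_image)
  have sf: "squarefree n"
    unfolding n prod[OF order_refl] by (rule squarefree_prod_primes) (use pr in auto)
  have n0: "n \<noteq> 0" using sf by (metis not_squarefree_0)
  show ?thesis
  proof (intro equalityI subsetI)
    fix d assume "d \<in> A_set p g r"
    then obtain I where I: "I \<subseteq> {1..g}" "card I = r" "d = (\<Prod>i\<in>I. p i)" by (auto simp: A_set_def)
    then have "d dvd n" unfolding n by (auto intro: prod_dvd_prod_subset)
    then show "d \<in> {d. d dvd n \<and> card (prime_factors d) = r}" using I pf card by simp
  next
    fix d assume "d \<in> {d. d dvd n \<and> card (prime_factors d) = r}"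
    then have d: "d dvd n" "card (prime_factors d) = r" by auto
    define I where "I = {i \<in> {1..g}. p i \<in> prime_factors d}"
    have I: "I \<subseteq> {1..g}" by (auto simp: I_def)
    have "prime_factors d \<subseteq> p ` {1..g}"
      using dvd_prime_factors[OF n0 d(1)] pf[OF order_refl] n by simp
    then have "p ` I = prime_factors d" by (auto simp: I_def)
    moreover have "\<Prod>(prime_factors d) = d"
      using squarefree_prod_prime_factors[OF squarefree_mono[OF d(1) sf]] .
    ultimately have "d = (\<Prod>i\<in>I. p i)" "card I = r" using prod[OF I] card[OF I] d by auto
    then show "d \<in> A_set p g r" using I by (auto simp: A_set_def)
  qed
qed

theorem theorem2p3:
  fixes g n q :: nat and p :: "nat \<Rightarrow> nat"
    and \<theta> :: "'a::{field,finite}" and K :: "'a set"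
  assumes "g \<ge> 1"
    and "inj_on p {1..g}"
    and "\<And>i. i \<in> {1..g} \<Longrightarrow> prime (p i) \<and> odd (p i)"
    and "n = (\<Prod>i=1..g. p i)"
    and "primepow q"
    and "coprime n q"
    and "CARD('a) = q ^ ord n q"
    and "primitive_root_of_unity n \<theta>"
    and "K = UNIV \<or> K = subfield_of_card q"
  shows "card {C \<in> qr_codes K p g \<theta>. LCD_code K n C}
           \<in> {0, \<Prod>r=0..g-1. (2 * (2 ^ (g - r) - 1)) ^ (g choose r)} \<and>
         card {C \<in> qr_codes K p g \<theta>. self_orthogonal K n C} \<in> {0, 2 ^ (g * 2 ^ (g - 1))}"
proof -
  note n_eq = assms(4)
  have primes: "prime (p i)" if "i \<in> {1..g}" for i using assms(3)[OF that] by blast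
  have n_prod: "n = \<Prod>(p ` {1..g})" using assms(2) by (simp add: n_eq prod.reindex)
  have "squarefree n" unfolding n_prod by (rule squarefree_prod_primes) (use primes in auto)
  have pf_n: "prime_factors n = p ` {1..g}"
    unfolding n_prod by (rule prime_factors_prod_primes) (use primes in auto)
  then have card_pf: "card (prime_factors n) = g" using assms(2) by (simp add: card_image)
  have "odd n" unfolding n_eq using assms(3) by (subst even_prod_iff) auto
  have "n \<noteq> 1" using card_pf assms(1) by auto
  moreover have "n \<noteq> 0" using odd_pos[OF \<open>odd n\<close>] by simp
  ultimately have "n > 1" by linarith

  \<comment> \<open>The characteristic divides the field size, hence the prime power
    \<open>q\<close>, so \<open>q\<close> is a power of it. This makes
    \<open>x \<mapsto> x ^ q\<close> additive and \<open>n\<close> nonzero in the field.\<close>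
  let ?c = "CHAR('a)"
  have prime_c: "prime ?c" using prime_CHAR_semidom finite_imp_CHAR_pos[of] by (metis finite_class.finite)
  have "?c dvd q ^ ord n q" using CHAR_dvd_CARD[where 'a = 'a] assms(7) by simp
  then have "?c dvd q" using prime_c prime_dvd_power by blast
  obtain l k where "prime l" "q = l ^ k" using assms(5) by (auto simp: primepow_def)
  then have q: "q = ?c ^ k" using \<open>?c dvd q\<close> prime_c by (metis prime_dvd_power primes_dvd_imp_eq)
  have "\<not> ?c dvd n"
    using \<open>?c dvd q\<close> assms(6) prime_c by (metis coprime_common_divisor not_prime_unit)
  then have of_nat_n: "of_nat n \<noteq> (0 :: 'a)" by (simp add: of_nat_eq_0_iff_char_dvd)
  define s where "s = (if K = UNIV then 1 else q)"
  have K: "K = {x. x ^ s = x}" using assms(9) by (auto simp: s_def subfield_of_card_def)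
  have "q > 0" using assms(5) by (simp add: primepow_gt_0_nat)

  interpret qr_code_setting n s \<theta> K
  proof
    show "(x + y) ^ s = x ^ s + y ^ s" for x y :: 'a
      using freshmans_dream'[OF prime_c q] by (simp add: s_def)
    show "coprime s n" using assms(6) by (simp add: s_def coprime_commute)
  qed (use \<open>squarefree n\<close> \<open>odd n\<close> \<open>n > 1\<close> of_nat_n K \<open>q > 0\<close> assms(8) in \<open>auto simp: s_def\<close>)

  have A: "A_set p g r = {d. d dvd n \<and> card (prime_factors d) = r}" for r
    by (rule A_set_eq[OF assms(2) primes n_eq])
  have A': "A_set p g r = {d \<in> D. card (prime_factors d) = r}" if "r \<in> {0..g - 1}" for r
    using that assms(1) card_pf by (auto simp: A D_def)
  have lt: "card (prime_factors d) \<in> {0..g - 1}" if "d \<in> D" for d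
    using card_prime_factors_div(2)[OF that] card_pf by auto
  have D_eq: "(\<Union>r\<in>{0..g-1}. A_set p g r) = D" using A' lt by auto
  have gen: "qr_generator p g \<theta> Q e = root_poly (zeros Q e)" for Q e
  proof -
    have "qr_generator p g \<theta> Q e =
        (\<Prod>r=0..g-1. \<Prod>d\<in>{d \<in> D. card (prime_factors d) = r}. F_poly n \<theta> d (Q d) (e d))"
      unfolding qr_generator_def n_eq[symmetric] by (intro prod.cong refl A')
    also have "\<dots> = (\<Prod>d\<in>D. F_poly n \<theta> d (Q d) (e d))"
      by (rule prod.group) (use finite_D lt in auto)
    finally show ?thesis unfolding prod_F_poly[OF inj_on_theta_pow] root_poly_def zeros_def .
  qed
  have codes: "qr_codes K p g \<theta> =
      {code Q e | Q e. valid Q e \<and> root_poly (zeros Q e) \<in> poly_over K}"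
    unfolding qr_codes_def n_eq[symmetric] D_eq gen code_def valid_def ..
  have "{C \<in> qr_codes K p g \<theta>. LCD_code K n C} = codes 1"
    unfolding codes by (rule codes_eqI) (rule LCD_code_iff)
  moreover have "{C \<in> qr_codes K p g \<theta>. self_orthogonal K n C} = codes (-1)"
    unfolding codes by (rule codes_eqI) (rule self_orthogonal_iff)
  ultimately show ?thesis
    using card_codes_1 card_codes_minus_1 card_pf prod_two_power_choose[OF assms(1)] by auto
qed

end
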